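(* Let $\alpha\in(1/2,1)$. Let $w_1=\mathbf{1}_n/n$ and, for every $t\in\mathbb{N}=\{1,2,\dots\}$, let $$w_{t+1}\in\operatorname*{arg\,min}_{w\in\Delta_n}\; g(w_t)+\langle\nabla g(w_t),w-w_t\rangle+B_h(w\|w_t),\qquad h(w)=\langle w,\log w\rangle,$$ or equivalently $w_{t+1}=\dfrac{w_t\odot\exp(-\nabla g(w_t))}{\langle w_t,\exp(-\nabla g(w_t))\rangle}$. Let $w_\star\in\operatorname*{arg\,min}_{w\in\Delta_n}g(w)$. Then for every $T\in\mathbb{N}$, $$g(w_{T+1})-g(w_\star)\leq\frac{\log n}{T}.$$
   Context: $\Delta_n$ is the probability simplex in $\mathbb{R}^n$, $\mathbf{1}_n$ the all-ones vector, $\odot$ the coordinate-wise product; $\exp$ and $\log$ of a vector are taken coordinate-wise (with $0\log 0=0$ in $h$). $\mathcal{D}_d$ is the set of Hermitian positive semi-definite unit-trace matrices in $\mathbb{C}^{d\times d}$. Matrix powers are defined through the eigendecomposition. Standing data: $A_1,\dots,A_n\in\mathcal{D}_d$ with $\sum_{j=1}^n A_j$ full-rank. For $A\in\mathcal{D}_d$ and $Q$ Hermitian positive semi-definite, $D_\alpha(A\|Q)=\frac{1}{\alpha-1}\log\left(\mathrm{Tr}[A^\alpha Q^{1-\alpha}]\right)$ whenever the right-hand side is well-defined, and $+\infty$ otherwise (Petz-Rényi divergence). Define $$g(w)=-\sum_{j=1}^n w[j]\,D_\alpha(A_j\|Q_\star(w)),\qquad Q_\star(w)\in\operatorname*{arg\,min}_{Q\in\mathcal{D}_d}\sum_{j=1}^n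 w[j]\,D_\alpha(A_j\|Q),$$ with the convention $0\cdot\infty=0$; that is, $g(w)=-\min_{Q\in\mathcal{D}_d}\sum_j w[j]D_\alpha(A_j\|Q)$. The quantity $C_\alpha=-\min_{w\in\Delta_n}g(w)$ is the Petz capacity of order $\alpha$. The same formula defines $g$ on the set of vectors in $\mathbb{R}^n$ with strictly positive entries, and $\nabla g$ is the gradient there; it is known that $\nabla g(w)[j]=-D_\alpha(A_j\|Q_\star(w))$. The Bregman divergence is $B_h(v\|u)=h(v)-h(u)-\langle\nabla h(u),v-u\rangle$. *)

theory Defs
  imports "HOL-Analysis.Analysis"
begin

section \<open>Matrices\<close>

definition conj_transpose :: "complex^'m^'n \<Rightarrow> complex^'n^'m" where
  "conj_transpose A = (\<chi> i j. cnj (A $ j $ i))"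

definition hermitian :: "complex^'d^'d \<Rightarrow> bool" where
  "hermitian A \<longleftrightarrow> conj_transpose A = A"

definition unitary :: "complex^'d^'d \<Rightarrow> bool" where
  "unitary U \<longleftrightarrow> conj_transpose U ** U = mat 1 \<and> U ** conj_transpose U = mat 1"

text \<open>For Hermitian \<open>A\<close> the quadratic form below is real, so taking \<open>Re\<close> loses nothing.\<close>

definition hermitian_psd :: "complex^'d^'d \<Rightarrow> bool" where
  "hermitian_psd A \<longleftrightarrow>
     hermitian A \<and> (\<forall>x :: complex^'d. 0 \<le> Re (\<Sum>i\<in>UNIV. cnj (x $ i) * (A *v x) $ i))"

definition density_matrices :: "(complex^'d^'d) set" where
  "density_matrices = {A. hermitian_psd A \<and> trace A = 1}"

definition real_diag :: "('d \<Rightarrow> real) \<Rightarrow> complex^'d^'d" where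
  "real_diag l = (\<chi> i j. if i = j then complex_of_real (l i) else 0)"

text \<open>
  The power of a Hermitian positive semi-definite matrix: the real exponent is applied to the
  eigenvalues in an eigendecomposition. The result does not depend on the decomposition chosen.
  Since \<open>0 powr p = 0\<close>, the kernel is preserved; below only exponents in the open interval
  from 0 to 1 occur, for which this is the usual convention.
\<close>

definition mat_powr :: "complex^'d^'d \<Rightarrow> real \<Rightarrow> complex^'d^'d" where
  "mat_powr A p =
     (THE B. \<exists>U l. unitary U \<and> A = U ** real_diag l ** conj_transpose U \<and>
                   B = U ** real_diag (\<lambda>i. l i powr p) ** conj_transpose U)"


section \<open>Petz-Renyi divergence\<close>

text \<open>
  Intended for \<open>0 < \<alpha> < 1\<close> and positive semi-definite \<open>A\<close>, \<open>Q\<close>. Both matrix powers then exist and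
  the trace is a nonnegative real, so the only way the formula can fail to be well-defined is
  that the trace vanishes.
\<close>

definition petz_div :: "real \<Rightarrow> complex^'d^'d \<Rightarrow> complex^'d^'d \<Rightarrow> ereal" where
  "petz_div \<alpha> A Q =
     (let \<tau> = Re (trace (mat_powr A \<alpha> ** mat_powr Q (1 - \<alpha>)))
      in if \<tau> > 0 then ereal (1 / (\<alpha> - 1) * ln \<tau>) else \<infinity>)"

text \<open>The product of extended reals satisfies \<open>0 * \<infinity> = 0\<close>, as required here.\<close>

definition weighted_div ::
  "real \<Rightarrow> ('n::finite \<Rightarrow> complex^'d^'d) \<Rightarrow> real^'n \<Rightarrow> complex^'d^'d \<Rightarrow> ereal" where
  "weighted_div \<alpha> A w Q = (\<Sum>j\<in>UNIV. ereal (w $ j) * petz_div \<alpha> (A j) Q)"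

definition Q_star :: "real \<Rightarrow> ('n::finite \<Rightarrow> complex^'d^'d) \<Rightarrow> real^'n \<Rightarrow> complex^'d^'d" where
  "Q_star \<alpha> A w = arg_min_on (weighted_div \<alpha> A w) density_matrices"

text \<open>
  For density matrices \<open>A j\<close>, \<open>0 < \<alpha> < 1\<close> and a vector \<open>w\<close> with nonnegative entries, the minimum
  of \<open>weighted_div \<alpha> A w\<close> is attained and finite (it is nonnegative, and finite at the maximally
  mixed state), so \<open>real_of_ereal\<close> loses nothing and the choice of minimiser is immaterial.
  One formula covers both the simplex and the positive orthant, on which the gradient is taken.
\<close>

definition petz_g :: "real \<Rightarrow> ('n::finite \<Rightarrow> complex^'d^'d) \<Rightarrow> real^'n \<Rightarrow> real" where
  "petz_g \<alpha> A w = real_of_ereal (- weighted_div \<alpha> A w (Q_star \<alpha> A w))"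


section \<open>Entropic mirror descent\<close>

definition prob_simplex :: "(real^'n) set" where
  "prob_simplex = {w. (\<forall>j. 0 \<le> w $ j) \<and> (\<Sum>j\<in>UNIV. w $ j) = 1}"

definition gradient :: "('a::real_inner \<Rightarrow> real) \<Rightarrow> 'a \<Rightarrow> 'a" where
  "gradient f x = (THE D. GDERIV f x :> D)"

definition bregman :: "('a::real_inner \<Rightarrow> real) \<Rightarrow> 'a \<Rightarrow> 'a \<Rightarrow> real" where
  "bregman h v u = h v - h u - gradient h u \<bullet> (v - u)"

text \<open>The convention \<open>0 log 0 = 0\<close> holds automatically.\<close>

definition neg_entropy :: "real^'n \<Rightarrow> real" where
  "neg_entropy w = w \<bullet> (\<chi> j. ln (w $ j))"

definition md_objective ::
  "real \<Rightarrow> ('n::finite \<Rightarrow> complex^'d^'d) \<Rightarrow> real^'n \<Rightarrow> real^'n \<Rightarrow> real" where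
  "md_objective \<alpha> A u v =
     petz_g \<alpha> A u + gradient (petz_g \<alpha> A) u \<bullet> (v - u) + bregman neg_entropy v u"

definition exp_neg_grad ::
  "real \<Rightarrow> ('n::finite \<Rightarrow> complex^'d^'d) \<Rightarrow> real^'n \<Rightarrow> real^'n" where
  "exp_neg_grad \<alpha> A u = (\<chi> j. exp (- gradient (petz_g \<alpha> A) u $ j))"

text \<open>The componentwise product on \<^typ>\<open>real^'n\<close> is the multiplication \<open>*\<close> of the library.\<close>

definition mult_update ::
  "real \<Rightarrow> ('n::finite \<Rightarrow> complex^'d^'d) \<Rightarrow> real^'n \<Rightarrow> real^'n" where
  "mult_update \<alpha> A u = (1 / (u \<bullet> exp_neg_grad \<alpha> A u)) *\<^sub>R (u * exp_neg_grad \<alpha> A u)"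

end

theory Submission
  imports Defs "HOL-Complex_Analysis.Conformal_Mappings"
begin

text \<open>
  Write \<open>p = 1 / (1 - \<alpha>)\<close>, \<open>B j = A j\<^sup>\<alpha>\<close> and \<open>S = Q\<^sup>1\<^sup>-\<^sup>\<alpha>\<close>. Then \<open>g w\<close> is the maximum of
  \<open>p * (\<Sum>j. w j * ln (Tr (B j * S)))\<close> over positive semi-definite \<open>S\<close> with \<open>Tr S\<^sup>p = 1\<close>, and its gradient at
  \<open>w\<close> has the entries \<open>p * ln (Tr (B j * S\<^sub>w))\<close> for a maximiser \<open>S\<^sub>w\<close>. All that the rate needs is
  \<open>(\<Sum>j. w j * (Tr (B j * S) / Tr (B j * S\<^sub>w))\<^sup>p) \<le> (\<Sum>j. w j)\<close> for every competitor \<open>S\<close>: combined with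
  \<open>ln t \<le> t - 1\<close> it gives both the differentiability of \<open>g\<close> and its smoothness, with constant 1,
  relative to the entropy, from which the rate follows by telescoping.

  The inequality says that \<open>S\<close> is mapped contractively to the sequence of the ratios, from the
  Schatten \<open>p\<close>-norm to the weighted \<open>\<ell>\<^sup>p\<close>-norm. By the first-order condition, \<open>S\<^sub>w\<close> is the power
  \<open>1 / (p - 1)\<close> of \<open>N = (\<Sum>j. w j * B j / Tr (B j * S\<^sub>w)) / (\<Sum>j. w j)\<close>; after symmetric rescaling by powers of
  \<open>N\<close> the bounds for the exponents \<open>\<infinity>\<close> and \<open>1\<close> are immediate, and the three lines theorem
  interpolates between them.
\<close>

section \<open>Hermitian matrices\<close>

text \<open>The complex inner product, conjugate-linear in the first argument. The product
  \<open>\<bullet>\<close> on complex vectors is only its real part (\<open>Re_cip\<close>), so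
  complex orthogonality and phases have to be expressed through \<open>cip\<close>.\<close>

definition cip :: "complex^'d \<Rightarrow> complex^'d \<Rightarrow> complex" where
  "cip x y = (\<Sum>i\<in>UNIV. cnj (x $ i) * y $ i)"

lemma Re_cip: "Re (cip x y) = x \<bullet> y"
  by (simp add: cip_def inner_vec_def inner_complex_def)

lemma cnj_cip: "cnj (cip x y) = cip y x"
  by (simp add: cip_def mult.commute)

lemma cip_self: "cip x x = of_real ((norm x)\<^sup>2)"
proof -
  have "Im (cip x x) = 0"
    using cnj_cip[of x x] by (metis Im_complex_of_real complex_eq_iff complex_cnj neg_equal_zero cnj.sel(2))
  moreover have "Re (cip x x) = (norm x)\<^sup>2"
    by (simp add: Re_cip power2_norm_eq_inner)
  ultimately show ?thesis by (simp add: complex_eq_iff)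
qed

lemma cip_simps:
  "cip x (y + z) = cip x y + cip x z" "cip x (y - z) = cip x y - cip x z"
  "cip x (c *s y) = c * cip x y" "cip (c *s x) y = cnj c * cip x y"
  "cip (x + y) z = cip x z + cip y z" "cip (x - y) z = cip x z - cip y z"
  "cip x 0 = 0" "cip 0 y = 0"
  by (simp_all add: cip_def algebra_simps sum.distrib sum_subtractf sum_distrib_left)

lemma cip_conj_transpose: "cip x (A *v y) = cip (conj_transpose A *v x) y"
proof -
  have "cip x (A *v y) = (\<Sum>i\<in>UNIV. \<Sum>j\<in>UNIV. cnj (x $ i) * (A $ i $ j * y $ j))"
    by (simp add: cip_def matrix_vector_mult_def sum_distrib_left)
  also have "\<dots> = (\<Sum>j\<in>UNIV. \<Sum>i\<in>UNIV. cnj (x $ i) * (A $ i $ j * y $ j))"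
    by (rule sum.swap)
  also have "\<dots> = cip (conj_transpose A *v x) y"
    by (simp add: cip_def matrix_vector_mult_def conj_transpose_def sum_distrib_left sum_distrib_right mult_ac)
  finally show ?thesis .
qed

lemma cip_hermitian: "hermitian A \<Longrightarrow> cip x (A *v y) = cip (A *v x) y"
  by (metis cip_conj_transpose hermitian_def)

lemma inner_hermitian: "hermitian A \<Longrightarrow> x \<bullet> (A *v y) = (A *v x) \<bullet> y"
  by (metis Re_cip cip_hermitian)

lemma conj_transpose_mult: "conj_transpose (A ** B) = conj_transpose B ** conj_transpose A"
  by (simp add: conj_transpose_def matrix_matrix_mult_def vec_eq_iff mult.commute)

lemma conj_transpose_conj_transpose [simp]: "conj_transpose (conj_transpose A) = A"
  by (simp add: conj_transpose_def vec_eq_iff)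

lemma conj_transpose_real_diag [simp]: "conj_transpose (real_diag l) = real_diag l"
  by (simp add: conj_transpose_def real_diag_def vec_eq_iff)

lemma unitary_conj_transpose: "unitary U \<Longrightarrow> unitary (conj_transpose U)"
  by (simp add: unitary_def)

lemma hermitian_conjugate: "hermitian (U ** real_diag l ** conj_transpose U)"
  by (simp add: hermitian_def conj_transpose_mult matrix_mul_assoc)

section \<open>Eigenvectors and the spectral theorem\<close>

lemma continuous_matrix_vector_mult [continuous_intros]:
  "continuous_on S (\<lambda>x. (A :: complex^'n^'m) *v x)"
  unfolding matrix_vector_mult_def
  by (rule continuous_on_vec_lambda) (intro continuous_intros)

lemma matrix_vector_scaleR: "(A :: complex^'n^'m) *v (c *\<^sub>R x) = c *\<^sub>R (A *v x)"
  by (simp add: matrix_vector_mult_def vec_eq_iff scaleR_right.sum)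

text \<open>The eigenvector \<open>e\<close> maximises the quadratic form on the unit sphere of the
  invariant subspace \<open>H\<close>. The residual \<open>y = A *v e - \<mu> *\<^sub>R e\<close>
  lies in \<open>H\<close> again, and maximality tested at \<open>e + t *\<^sub>R y\<close> gives
  \<open>2 * t * (y \<bullet> y) \<le> t^2 * b\<close> for every \<open>t\<close>, which forces
  \<open>y = 0\<close>.\<close>

lemma rayleigh_maximizer_eigenvector:
  fixes A :: "complex^'d^'d"
  assumes herm: "hermitian A"
    and add: "\<And>x y. x \<in> H \<Longrightarrow> y \<in> H \<Longrightarrow> x + y \<in> H"
    and scale: "\<And>x c. x \<in> H \<Longrightarrow> c *s x \<in> H"
    and inv: "\<And>x. x \<in> H \<Longrightarrow> A *v x \<in> H"
    and clo: "closed H" and ne: "x0 \<in> H" "x0 \<noteq> 0"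
  obtains e \<mu> where "e \<in> H" "norm e = 1" "A *v e = of_real \<mu> *s e"
proof -
  have sc: "a *\<^sub>R x \<in> H" if "x \<in> H" for a x
  proof -
    have "a *\<^sub>R x = of_real a *s x" by (simp add: vec_eq_iff scaleR_conv_of_real[symmetric])
    thus ?thesis using scale[OF that] by metis
  qed
  define K where "K = H \<inter> sphere 0 1"
  have "compact K" unfolding K_def using clo by (simp add: closed_Int_compact)
  moreover have "(1 / norm x0) *\<^sub>R x0 \<in> K" using ne sc by (simp add: K_def)
  hence "K \<noteq> {}" by auto
  moreover have "continuous_on K (\<lambda>x. x \<bullet> (A *v x))" by (intro continuous_intros)
  ultimately obtain e where e: "e \<in> K" "\<And>y. y \<in> K \<Longrightarrow> y \<bullet> (A *v y) \<le> e \<bullet> (A *v e)"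
    using continuous_attains_sup by (metis (no_types, lifting))
  define \<mu> where "\<mu> = e \<bullet> (A *v e)"
  have eH: "e \<in> H" "norm e = 1" using e by (auto simp: K_def)
  have R: "y \<bullet> (A *v y) \<le> \<mu> * (y \<bullet> y)" if "y \<in> H" for y
  proof (cases "y = 0")
    case False
    have "(1 / norm y) *\<^sub>R y \<in> K" using that False sc by (simp add: K_def)
    from e(2)[OF this] have "(1/norm y) * ((1/norm y) * (y \<bullet> (A *v y))) \<le> \<mu>"
      by (simp add: \<mu>_def matrix_vector_scaleR)
    hence "(norm y)\<^sup>2 * ((1/norm y) * ((1/norm y) * (y \<bullet> (A *v y)))) \<le> (norm y)\<^sup>2 * \<mu>"
      by (intro mult_left_mono) auto
    moreover have "(norm y)\<^sup>2 * ((1/norm y) * ((1/norm y) * q)) = q" for q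
      using False by (simp add: power2_eq_square)
    ultimately show ?thesis by (simp add: dot_square_norm mult.commute)
  qed simp
  define y where "y = A *v e - \<mu> *\<^sub>R e"
  have yH: "y \<in> H"
    unfolding y_def using add[OF inv[OF eH(1)] sc[OF eH(1), of "-\<mu>"]] by simp
  define b where "b = \<mu> * (y \<bullet> y) - y \<bullet> (A *v y)"
  have ee: "e \<bullet> e = 1" using eH(2) by (simp add: norm_eq_1)
  have main: "2 * t * (y \<bullet> y) \<le> t^2 * b" for t
  proof -
    have m1: "(e + t *\<^sub>R y) \<bullet> (A *v (e + t *\<^sub>R y)) \<le> \<mu> * ((e + t *\<^sub>R y) \<bullet> (e + t *\<^sub>R y))"
      by (intro R add eH sc yH)
    have m2: "(e + t *\<^sub>R y) \<bullet> (A *v (e + t *\<^sub>R y)) = \<mu> + 2 * t * (y \<bullet> (A *v e)) + t^2 * (y \<bullet> (A *v y))"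
    proof -
      have "A *v (e + t *\<^sub>R y) = A *v e + t *\<^sub>R (A *v y)"
        by (simp add: matrix_vector_right_distrib matrix_vector_scaleR)
      moreover have "e \<bullet> (A *v y) = y \<bullet> (A *v e)"
        using inner_hermitian[OF herm] by (metis inner_commute)
      ultimately show ?thesis
        by (simp add: inner_add_left inner_add_right \<mu>_def algebra_simps power2_eq_square)
    qed
    have m3: "(e + t *\<^sub>R y) \<bullet> (e + t *\<^sub>R y) = 1 + 2 * t * (y \<bullet> e) + t^2 * (y \<bullet> y)"
      by (simp add: inner_add_left inner_add_right ee inner_commute algebra_simps power2_eq_square)
    have m4: "y \<bullet> (A *v e) = y \<bullet> y + \<mu> * (y \<bullet> e)"
      by (simp add: y_def inner_diff_right inner_diff_left algebra_simps)
    show ?thesis using m1 unfolding m2 m3 m4 b_def by (simp add: algebra_simps)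
  qed
  have "y \<bullet> y = 0"
  proof (rule ccontr)
    assume "y \<bullet> y \<noteq> 0"
    hence pos: "y \<bullet> y > 0" by (simp add: less_le)
    \<comment> \<open>Small enough that \<open>t * b\<close> is at most
      \<open>y \<bullet> y\<close>, contradicting the lower bound
      \<open>2 * (y \<bullet> y)\<close>; the added 1 keeps the denominator positive.\<close>
    define t where "t = (y \<bullet> y) / (\<bar>b\<bar> + 1)"
    have t: "t > 0" using pos by (simp add: t_def)
    have "2 * (y \<bullet> y) \<le> t * b" using main[of t] t by (simp add: power2_eq_square)
    also have "\<dots> \<le> t * (\<bar>b\<bar> + 1)" using t by (intro mult_left_mono) auto
    also have "\<dots> = y \<bullet> y" by (simp add: t_def)
    finally show False using pos by simp
  qed
  hence "A *v e = \<mu> *\<^sub>R e" by (simp add: y_def)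
  also have "\<dots> = of_real \<mu> *s e" by (simp add: vec_eq_iff scaleR_conv_of_real[symmetric])
  finally show ?thesis using that eH by blast
qed

text \<open>A dimension count over the reals: the \<open>f i\<close> together with their multiples
  by \<open>\<i>\<close> span a real space of dimension at most \<open>2 * k\<close>, below the real
  dimension \<open>2 * CARD('d)\<close>. Real orthogonality to both \<open>f i\<close> and
  \<open>\<i> *s f i\<close> kills the real and the imaginary part of
  \<open>cip (f i) x\<close>.\<close>

lemma cip_orthogonal_exists:
  fixes f :: "nat \<Rightarrow> complex^'d"
  assumes "k < CARD('d)"
  obtains x where "x \<noteq> 0" "\<And>i. i < k \<Longrightarrow> cip (f i) x = 0"
proof -
  define G where "G = f ` {..<k} \<union> (\<lambda>i. \<i> *s f i) ` {..<k}"
  have fin: "finite G" by (simp add: G_def)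
  have "dim G \<le> card G" using fin by (simp add: dim_le_card')
  also have "card G \<le> k + k" unfolding G_def
    by (rule order.trans[OF card_Un_le]) (intro add_mono order.trans[OF card_image_le], auto)
  also have "\<dots> < DIM(complex^'d)" using assms by simp
  finally obtain x where x: "x \<noteq> 0" "\<And>y. y \<in> span G \<Longrightarrow> orthogonal x y"
    using orthogonal_to_subspace_exists by blast
  have "cip (f i) x = 0" if "i < k" for i
  proof -
    have "f i \<in> span G" "\<i> *s f i \<in> span G" using that by (auto simp: G_def intro: span_base)
    hence "f i \<bullet> x = 0" "(\<i> *s f i) \<bullet> x = 0" using x(2) by (metis orthogonal_def inner_commute)+
    hence "Re (cip (f i) x) = 0" "Re (cip (\<i> *s f i) x) = 0" by (auto simp: Re_cip)
    thus ?thesis by (simp add: cip_simps complex_eq_iff)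
  qed
  with x that show ?thesis by blast
qed

text \<open>Orthonormal eigenvectors are collected one at a time. The complement \<open>H\<close> of
  those already found is invariant because \<open>A\<close> is Hermitian, and it is nonzero as long
  as fewer than \<open>CARD('d)\<close> have been found, so it contains another eigenvector.\<close>

lemma hermitian_spectral:
  fixes A :: "complex^'d^'d"
  assumes herm: "hermitian A"
  obtains U l where "unitary U" "A = U ** real_diag l ** conj_transpose U"
proof -
  have ex: "\<exists>f \<mu>. (\<forall>i<k. \<forall>j<k. cip (f i) (f j) = (if i = j then 1 else 0)) \<and>
          (\<forall>i<k. A *v f i = of_real (\<mu> i) *s f i)" if "k \<le> CARD('d)" for k :: nat
    using that
  proof (induction k)
    case 0 thus ?case by simp
  next
    case (Suc k)
    then obtain f :: "nat \<Rightarrow> complex^'d" and \<mu> where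
      f: "\<And>i j. i < k \<Longrightarrow> j < k \<Longrightarrow> cip (f i) (f j) = (if i = j then 1 else 0)"
         "\<And>i. i < k \<Longrightarrow> A *v f i = of_real (\<mu> i) *s f i" by auto
    define H where "H = {x. \<forall>i<k. cip (f i) x = 0}"
    obtain x0 where x0: "x0 \<noteq> 0" "\<And>i. i < k \<Longrightarrow> cip (f i) x0 = 0"
      using cip_orthogonal_exists[of k f] Suc.prems by auto
    have clo: "closed H"
    proof -
      have "H = (\<Inter>i\<in>{..<k}. {x. cip (f i) x = 0})" by (auto simp: H_def)
      thus ?thesis by (auto simp: cip_def intro!: closed_INT closed_Collect_eq continuous_intros)
    qed
    obtain e \<nu> where e: "e \<in> H" "norm e = 1" "A *v e = of_real \<nu> *s e"
    proof (rule rayleigh_maximizer_eigenvector[OF herm, of H x0])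
      show "A *v x \<in> H" if "x \<in> H" for x
        using that f(2) by (auto simp: H_def cip_hermitian[OF herm] cip_simps)
    qed (use clo x0 in \<open>auto simp: H_def cip_simps\<close>)
    have e0: "cip (f i) e = 0" "cip e (f i) = 0" if "i < k" for i
      using e(1) that cnj_cip[of "f i" e] by (auto simp: H_def)
    have "cip e e = 1" using e(2) by (simp add: cip_self)
    thus ?case
      using f e e0
      by (intro exI[of _ "f(k := e)"] exI[of _ "\<mu>(k := \<nu>)"]) (auto simp: less_Suc_eq)
  qed
  obtain f :: "nat \<Rightarrow> complex^'d" and \<mu> where
      f: "\<And>i j. i < CARD('d) \<Longrightarrow> j < CARD('d) \<Longrightarrow> cip (f i) (f j) = (if i = j then 1 else 0)"
         "\<And>i. i < CARD('d) \<Longrightarrow> A *v f i = of_real (\<mu> i) *s f i"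
    using ex[OF order.refl] by auto
  \<comment> \<open>The induction numbers the eigenvectors by naturals; \<open>h\<close> moves them
    to the index type of the matrix.\<close>
  obtain h :: "'d \<Rightarrow> nat" where h: "bij_betw h UNIV {..<CARD('d)}"
    using ex_bij_betw_finite_nat[of "UNIV :: 'd set"] by (auto simp: atLeast0LessThan)
  have hlt: "h i < CARD('d)" for i using h by (auto simp: bij_betw_def)
  have hinj: "h i = h j \<longleftrightarrow> i = j" for i j using h by (auto simp: bij_betw_def inj_eq)
  define U :: "complex^'d^'d" where "U = (\<chi> i j. f (h j) $ i)"
  define l where "l = \<mu> \<circ> h"
  have 1: "conj_transpose U ** U = mat 1"
  proof -
    have "(conj_transpose U ** U) $ i $ j = cip (f (h i)) (f (h j))" for i j
      by (simp add: conj_transpose_def U_def matrix_matrix_mult_def cip_def)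
    thus ?thesis by (simp add: vec_eq_iff f hlt hinj mat_def)
  qed
  hence 2: "U ** conj_transpose U = mat 1" by (simp add: matrix_left_right_inverse)
  have "(A ** U) $ i $ j = (U ** real_diag l) $ i $ j" for i j
  proof -
    have "(A ** U) $ i $ j = (A *v f (h j)) $ i"
      by (simp add: matrix_matrix_mult_def matrix_vector_mult_def U_def)
    also have "\<dots> = of_real (l j) * f (h j) $ i" by (simp add: f hlt l_def)
    also have "\<dots> = (U ** real_diag l) $ i $ j"
      by (simp add: matrix_matrix_mult_def U_def real_diag_def if_distrib if_distribR cong: if_cong)
    finally show ?thesis .
  qed
  hence "A ** U = U ** real_diag l" by (simp add: vec_eq_iff)
  hence "A = U ** real_diag l ** conj_transpose U"
    by (metis 2 matrix_mul_assoc matrix_mul_rid)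
  with 1 2 that show ?thesis by (auto simp: unitary_def)
qed

section \<open>Powers of positive semi-definite matrices\<close>

definition spectral :: "complex^'d^'d \<Rightarrow> ('d \<Rightarrow> real) \<Rightarrow> complex^'d^'d" where
  "spectral U l = U ** real_diag l ** conj_transpose U"

definition tr_prod :: "complex^'d^'d \<Rightarrow> complex^'d^'d \<Rightarrow> real" where
  "tr_prod A B = Re (trace (A ** B))"

text \<open>For positive semi-definite \<open>A\<close> and positive \<open>p\<close> this is the
  \<open>p\<close>-th power of the Schatten \<open>p\<close>-norm.\<close>

definition trace_powr :: "complex^'d^'d \<Rightarrow> real \<Rightarrow> real" where
  "trace_powr A p = Re (trace (mat_powr A p))"

section \<open>Positive semi-definite matrices and their eigendecompositions\<close>

lemma hermitian_psd_inner: "hermitian_psd A \<longleftrightarrow> hermitian A \<and> (\<forall>x. 0 \<le> x \<bullet> (A *v x))"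
  by (simp add: hermitian_psd_def flip: Re_cip cip_def)

lemma hermitian_psd_add: "hermitian_psd A \<Longrightarrow> hermitian_psd B \<Longrightarrow> hermitian_psd (A + B)"
  by (auto simp: hermitian_psd_inner hermitian_def conj_transpose_def vec_eq_iff
      matrix_vector_mult_add_rdistrib inner_add_right)

lemma scaleR_matrix_vector: "(c *\<^sub>R (A :: complex^'n^'m)) *v x = c *\<^sub>R (A *v x)"
  by (simp add: matrix_vector_mult_def vec_eq_iff scaleR_right.sum)

lemma hermitian_psd_scaleR: "hermitian_psd A \<Longrightarrow> 0 \<le> c \<Longrightarrow> hermitian_psd (c *\<^sub>R A)"
  by (auto simp: hermitian_psd_inner hermitian_def conj_transpose_def vec_eq_iff scaleR_matrix_vector)

lemma hermitian_psd_0: "hermitian_psd 0"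
  by (simp add: hermitian_psd_inner hermitian_def conj_transpose_def vec_eq_iff)

lemma hermitian_psd_sum: "(\<And>i. i \<in> I \<Longrightarrow> hermitian_psd (f i)) \<Longrightarrow> hermitian_psd (\<Sum>i\<in>I. f i)"
  by (induction I rule: infinite_finite_induct) (auto simp: hermitian_psd_0 hermitian_psd_add)

lemma cip_conjugate: "cip x ((conj_transpose U ** B ** U) *v y) = cip (U *v x) (B *v (U *v y))"
  using cip_conj_transpose[of x "conj_transpose U" "B *v (U *v y)"]
  by (simp add: matrix_vector_mul_assoc matrix_mul_assoc)

lemma hermitian_psd_conjugate:
  assumes "hermitian_psd B" shows "hermitian_psd (conj_transpose U ** B ** U)"
proof -
  have "0 \<le> x \<bullet> ((conj_transpose U ** B ** U) *v x)" for x
    using assms by (simp add: cip_conjugate hermitian_psd_inner flip: Re_cip)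
  moreover have "hermitian (conj_transpose U ** B ** U)"
    using assms by (simp add: hermitian_psd_def hermitian_def conj_transpose_mult matrix_mul_assoc)
  ultimately show ?thesis by (simp add: hermitian_psd_inner)
qed

lemma real_diag_mult_vec: "(real_diag l *v x) $ i = of_real (l i) * x $ i"
  by (simp add: real_diag_def matrix_vector_mult_def if_distrib if_distribR cong: if_cong)

lemma real_diag_quadratic: "x \<bullet> (real_diag l *v x) = (\<Sum>i\<in>UNIV. l i * (cmod (x $ i))\<^sup>2)"
  by (simp add: real_diag_mult_vec cip_def cmod_power2 algebra_simps flip: Re_cip)
    (simp add: power2_eq_square)

lemma spectral_quadratic:
  "x \<bullet> (spectral U l *v x) = (\<Sum>i\<in>UNIV. l i * (cmod ((conj_transpose U *v x) $ i))\<^sup>2)"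
  using cip_conjugate[of x "conj_transpose U" "real_diag l" x]
  by (simp add: spectral_def Re_cip flip: real_diag_quadratic) (simp flip: Re_cip)

lemma hermitian_psd_spectral:
  assumes "\<And>i. 0 \<le> l i" shows "hermitian_psd (spectral U l)"
  using assms by (auto simp: hermitian_psd_inner spectral_quadratic intro!: sum_nonneg)
    (simp add: spectral_def hermitian_conjugate)

lemma unitary_cancel_left:
  assumes "unitary U"
  shows "conj_transpose U *v (U *v x) = x"
  using assms by (simp add: unitary_def matrix_vector_mul_assoc)

lemma spectral_nonneg:
  assumes "unitary U" "hermitian_psd (spectral U l)"
  shows "0 \<le> l i"
proof -
  \<comment> \<open>The test vector is the eigenvector belonging to \<open>l i\<close>.\<close>
  have "0 \<le> (U *v axis i 1) \<bullet> (spectral U l *v (U *v axis i 1))"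
    using assms by (simp add: hermitian_psd_inner)
  also have "\<dots> = (\<Sum>k\<in>UNIV. if k = i then l i else 0)"
    unfolding spectral_quadratic unitary_cancel_left[OF assms(1)]
    by (rule sum.cong) (auto simp: axis_def)
  finally show ?thesis by simp
qed

lemma psd_spectral:
  assumes "hermitian_psd A"
  obtains U l where "unitary U" "\<And>i. 0 \<le> l i" "A = spectral U l"
proof -
  have "hermitian A" using assms by (simp add: hermitian_psd_def)
  then obtain U l where "unitary U" "A = spectral U l"
    by (rule hermitian_spectral) (simp add: spectral_def that)
  with assms show ?thesis
    by (intro that[of U l]) (auto intro: spectral_nonneg)
qed

section \<open>Independence of the decomposition, and the algebra of matrix powers\<close>

lemma real_diag_mult_right: "(A ** real_diag l) $ i $ j = A $ i $ j * of_real (l j)"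
  by (simp add: real_diag_def matrix_matrix_mult_def if_distrib if_distribR cong: if_cong)

lemma real_diag_mult_left: "(real_diag l ** A) $ i $ j = of_real (l i) * A $ i $ j"
  by (simp add: real_diag_def matrix_matrix_mult_def if_distrib if_distribR cong: if_cong)

text \<open>Equality means that \<open>conj_transpose V ** U\<close> intertwines the two diagonal
  matrices, which is a condition on each entry separately. The condition survives applying one
  function to both families of eigenvalues; it therefore makes matrix powers well defined and also
  serves to recognise the equality case in \<open>young_trace\<close>.\<close>

lemma spectral_eq_iff:
  assumes "unitary U" "unitary V"
  shows "spectral U l = spectral V m \<longleftrightarrow>
    (\<forall>i j. (conj_transpose V ** U) $ i $ j = 0 \<or> m i = l j)"
proof -
  let ?W = "conj_transpose V ** U"
  have "spectral U l = spectral V m \<longleftrightarrow> ?W ** real_diag l = real_diag m ** ?W"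
  proof
    assume "spectral U l = spectral V m"
    hence "conj_transpose V ** spectral U l ** U = conj_transpose V ** spectral V m ** U" by simp
    thus "?W ** real_diag l = real_diag m ** ?W"
      using assms unfolding spectral_def unitary_def
      by (metis matrix_mul_assoc matrix_mul_lid matrix_mul_rid)
  next
    assume "?W ** real_diag l = real_diag m ** ?W"
    hence "V ** (?W ** real_diag l) ** conj_transpose U = V ** (real_diag m ** ?W) ** conj_transpose U"
      by simp
    thus "spectral U l = spectral V m"
      using assms unfolding spectral_def unitary_def
      by (metis matrix_mul_assoc matrix_mul_lid matrix_mul_rid)
  qed
  also have "\<dots> \<longleftrightarrow> (\<forall>i j. ?W $ i $ j = 0 \<or> m i = l j)"
    unfolding vec_eq_iff real_diag_mult_left real_diag_mult_right by (simp add: mult.commute) (metis of_real_eq_iff)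
  finally show ?thesis .
qed

text \<open>Any other decomposition of the same matrix satisfies the criterion of
  \<open>spectral_eq_iff\<close>, and so do the powers of the two families of eigenvalues. Hence the
  description by \<open>THE\<close> has a unique solution, and it can be computed in any
  eigenbasis.\<close>

lemma mat_powr_spectral:
  assumes "unitary U"
  shows "mat_powr (spectral U l) p = spectral U (\<lambda>i. l i powr p)"
  unfolding mat_powr_def spectral_def[symmetric]
proof (rule the_equality)
  show "\<exists>V m. unitary V \<and> spectral U l = spectral V m \<and>
      spectral U (\<lambda>i. l i powr p) = spectral V (\<lambda>i. m i powr p)"
    using assms by blast
next
  fix B assume "\<exists>V m. unitary V \<and> spectral U l = spectral V m \<and> B = spectral V (\<lambda>i. m i powr p)"
  then obtain V m where V: "unitary V" "spectral U l = spectral V m" "B = spectral V (\<lambda>i. m i powr p)"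
    by blast
  have "(conj_transpose V ** U) $ i $ j = 0 \<or> m i powr p = l j powr p" for i j
    using V(2) unfolding spectral_eq_iff[OF assms V(1)] by metis
  hence "spectral U (\<lambda>i. l i powr p) = spectral V (\<lambda>i. m i powr p)"
    unfolding spectral_eq_iff[OF assms V(1)] by blast
  thus "B = spectral U (\<lambda>i. l i powr p)" using V(3) by simp
qed

lemma hermitian_psd_mat_powr:
  assumes "hermitian_psd A" shows "hermitian_psd (mat_powr A p)"
proof -
  obtain U l where "unitary U" "\<And>i. 0 \<le> l i" "A = spectral U l"
    using psd_spectral[OF assms] by blast
  thus ?thesis by (simp add: mat_powr_spectral hermitian_psd_spectral)
qed

lemma mat_powr_mat_powr:
  assumes "hermitian_psd A" shows "mat_powr (mat_powr A a) b = mat_powr A (a * b)"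
proof -
  obtain U l where "unitary U" "\<And>i. 0 \<le> l i" "A = spectral U l"
    using psd_spectral[OF assms] by blast
  thus ?thesis by (simp add: mat_powr_spectral powr_powr)
qed

lemma mat_powr_1:
  assumes "hermitian_psd A" shows "mat_powr A 1 = A"
proof -
  obtain U l where "unitary U" "\<And>i. 0 \<le> l i" "A = spectral U l"
    using psd_spectral[OF assms] by blast
  thus ?thesis by (simp add: mat_powr_spectral)
qed

lemma spectral_scaleR: "c *\<^sub>R spectral U l = spectral U (\<lambda>i. c * l i)"
proof -
  have "c *\<^sub>R real_diag l = real_diag (\<lambda>i. c * l i)"
    by (simp add: real_diag_def vec_eq_iff scaleR_conv_of_real[where 'a = complex])
  thus ?thesis unfolding spectral_def
    by (metis matrix_scalar_ac scalar_matrix_assoc)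
qed

lemma mat_powr_scaleR:
  assumes "hermitian_psd A" "0 \<le> c" shows "mat_powr (c *\<^sub>R A) p = c powr p *\<^sub>R mat_powr A p"
proof -
  obtain U l where "unitary U" "\<And>i. 0 \<le> l i" "A = spectral U l"
    using psd_spectral[OF assms(1)] by blast
  thus ?thesis using assms(2) by (simp add: spectral_scaleR mat_powr_spectral powr_mult)
qed

section \<open>Traces of powers and the trace pairing\<close>

lemma trace_spectral:
  assumes "unitary U" shows "trace (spectral U l) = of_real (\<Sum>i\<in>UNIV. l i)"
proof -
  have "trace (spectral U l) = trace (conj_transpose U ** (U ** real_diag l))"
    unfolding spectral_def by (rule trace_mul_sym)
  also have "\<dots> = trace (real_diag l)"
    using assms by (simp add: matrix_mul_assoc unitary_def)
  also have "\<dots> = of_real (\<Sum>i\<in>UNIV. l i)" by (simp add: trace_def real_diag_def)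
  finally show ?thesis .
qed

lemma trace_powr_spectral: "unitary U \<Longrightarrow> trace_powr (spectral U l) p = (\<Sum>i\<in>UNIV. l i powr p)"
  by (simp add: trace_powr_def mat_powr_spectral trace_spectral)

lemma tr_prod_commute: "tr_prod A B = tr_prod B A"
  unfolding tr_prod_def by (subst trace_mul_sym) (rule refl)

lemma tr_prod_add_left: "tr_prod (A + B) C = tr_prod A C + tr_prod B C"
  by (simp add: tr_prod_def trace_def matrix_matrix_mult_def sum.distrib algebra_simps)

lemma tr_prod_scaleR_left: "tr_prod (c *\<^sub>R A) C = c * tr_prod A C"
  by (simp add: tr_prod_def trace_def matrix_matrix_mult_def sum_distrib_left scaleR_right.sum)

lemma tr_prod_0_left: "tr_prod 0 C = 0"
  by (simp add: tr_prod_def trace_def matrix_matrix_mult_def)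

lemma tr_prod_sum_left: "tr_prod (\<Sum>i\<in>I. f i) C = (\<Sum>i\<in>I. tr_prod (f i) C)"
  by (induction I rule: infinite_finite_induct) (auto simp: tr_prod_0_left tr_prod_add_left)

lemma tr_prod_add_right: "tr_prod C (A + B) = tr_prod C A + tr_prod C B"
  by (metis tr_prod_add_left tr_prod_commute)

lemma tr_prod_scaleR_right: "tr_prod C (c *\<^sub>R A) = c * tr_prod C A"
  by (metis tr_prod_scaleR_left tr_prod_commute)

lemma tr_prod_spectral_right:
  "tr_prod B (spectral U l) = (\<Sum>i\<in>UNIV. l i * Re ((conj_transpose U ** B ** U) $ i $ i))"
proof -
  have "trace (B ** spectral U l) = trace (conj_transpose U ** (B ** (U ** real_diag l)))"
    unfolding spectral_def by (metis matrix_mul_assoc trace_mul_sym)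
  also have "\<dots> = trace (conj_transpose U ** B ** U ** real_diag l)"
    by (simp add: matrix_mul_assoc)
  finally show ?thesis
    by (simp add: tr_prod_def trace_def real_diag_mult_right mult.commute)
qed

lemma conjugate_diag_entry:
  "Re ((conj_transpose U ** B ** U) $ i $ i) = (U *v axis i 1) \<bullet> (B *v (U *v axis i 1))"
proof -
  have "(conj_transpose U ** B ** U) $ i $ i = cip (axis i 1) ((conj_transpose U ** B ** U) *v axis i 1)"
    by (simp add: cip_def axis_def matrix_vector_mult_def if_distrib if_distribR cong: if_cong)
  thus ?thesis by (simp add: cip_conjugate Re_cip)
qed

lemma tr_prod_nonneg:
  assumes "hermitian_psd A" "hermitian_psd B" shows "0 \<le> tr_prod A B"
proof -
  obtain U l where "unitary U" "\<And>i. 0 \<le> l i" "B = spectral U l"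
    using psd_spectral[OF assms(2)] by blast
  thus ?thesis using assms(1)
    by (auto simp: tr_prod_spectral_right conjugate_diag_entry hermitian_psd_inner intro!: sum_nonneg)
qed

lemma unitary_mult: "unitary U \<Longrightarrow> unitary V \<Longrightarrow> unitary (U ** V)"
  unfolding unitary_def conj_transpose_mult
  by (metis matrix_mul_assoc matrix_mul_lid)

lemma unitary_row_norm:
  assumes "unitary W" shows "(\<Sum>j\<in>UNIV. (cmod (W $ i $ j))\<^sup>2) = 1"
proof -
  have "(W ** conj_transpose W) $ i $ i = 1" using assms by (simp add: unitary_def mat_def)
  hence "(\<Sum>j\<in>UNIV. complex_of_real ((cmod (W $ i $ j))\<^sup>2)) = 1"
    by (simp add: matrix_matrix_mult_def conj_transpose_def flip: complex_norm_square)
  thus ?thesis by (metis of_real_eq_1_iff of_real_sum)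
qed

lemma unitary_column_norm:
  assumes "unitary W" shows "(\<Sum>i\<in>UNIV. (cmod (W $ i $ j))\<^sup>2) = 1"
  using unitary_row_norm[OF unitary_conj_transpose[OF assms], of j] by (simp add: conj_transpose_def)

text \<open>For unitary \<open>U\<close> and \<open>V\<close> the squared moduli form a doubly
  stochastic matrix (\<open>unitary_row_norm\<close>, \<open>unitary_column_norm\<close>). A trace
  inequality for two non-commuting matrices thereby becomes an average of scalar inequalities
  between their eigenvalues.\<close>

lemma tr_prod_spectral:
  "tr_prod (spectral U l) (spectral V m) =
    (\<Sum>i\<in>UNIV. \<Sum>j\<in>UNIV. l i * m j * (cmod ((conj_transpose U ** V) $ i $ j))\<^sup>2)"
proof -
  let ?W = "conj_transpose U ** V"
  have "conj_transpose V ** spectral U l ** V = conj_transpose ?W ** (real_diag l ** ?W)"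
    by (simp add: spectral_def conj_transpose_mult matrix_mul_assoc)
  hence "Re ((conj_transpose V ** spectral U l ** V) $ j $ j) = (\<Sum>i\<in>UNIV. l i * (cmod (?W $ i $ j))\<^sup>2)" for j
    unfolding matrix_matrix_mult_def[of "conj_transpose ?W"]
    by (simp add: real_diag_mult_left conj_transpose_def[of ?W] cmod_power2 algebra_simps)
      (simp add: power2_eq_square)
  thus ?thesis
    by (simp add: tr_prod_spectral_right sum_distrib_left mult_ac) (rule sum.swap)
qed

lemma tr_prod_mat_powr:
  assumes "hermitian_psd A" shows "tr_prod (mat_powr A a) (mat_powr A b) = trace_powr A (a + b)"
proof -
  obtain U l where U: "unitary U" "\<And>i. 0 \<le> l i" "A = spectral U l"
    using psd_spectral[OF assms] by blast
  have "conj_transpose U ** U = mat 1" using U(1) by (simp add: unitary_def)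
  thus ?thesis using U
    by (simp add: mat_powr_spectral tr_prod_spectral trace_powr_spectral powr_add mat_def
        if_distrib if_distribR cong: if_cong)
qed

lemma trace_powr_mat_powr:
  "hermitian_psd A \<Longrightarrow> trace_powr (mat_powr A a) b = trace_powr A (a * b)"
  by (simp add: trace_powr_def mat_powr_mat_powr)

lemma trace_powr_scaleR:
  assumes "hermitian_psd A" "0 \<le> c" shows "trace_powr (c *\<^sub>R A) p = c powr p * trace_powr A p"
  by (simp add: trace_powr_def mat_powr_scaleR[OF assms] trace_def scaleR_right.sum sum_distrib_left)

lemma trace_powr_nonneg:
  assumes "hermitian_psd A" shows "0 \<le> trace_powr A p"
proof -
  obtain U l where "unitary U" "\<And>i. 0 \<le> l i" "A = spectral U l"
    using psd_spectral[OF assms] by blast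
  thus ?thesis by (simp add: trace_powr_spectral sum_nonneg)
qed

section \<open>Young's inequality for scalars and for traces\<close>

lemma weighted_exp_mean:
  fixes x y t :: real
  assumes "0 < t" "t < 1"
  shows "exp ((1 - t) * x + t * y) \<le> (1 - t) * exp x + t * exp y"
    and "exp ((1 - t) * x + t * y) = (1 - t) * exp x + t * exp y \<Longrightarrow> x = y"
proof -
  \<comment> \<open>The tangent of \<open>exp\<close> at the weighted mean \<open>m\<close> lies
    below \<open>exp\<close> and is averaged over \<open>x\<close> and \<open>y\<close>. It touches
    the graph at \<open>m\<close> only, which yields the equality case.\<close>
  define m where "m = (1 - t) * x + t * y"
  have 1: "exp m * (1 + (x - m)) \<le> exp x" "exp m * (1 + (y - m)) \<le> exp y"
    using exp_ge_add_one_self[of "x - m"] exp_ge_add_one_self[of "y - m"]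
    by (simp_all add: exp_diff field_simps)
  have "exp m = (1 - t) * (exp m * (1 + (x - m))) + t * (exp m * (1 + (y - m)))"
    by (simp add: m_def algebra_simps)
  also have "\<dots> \<le> (1 - t) * exp x + t * exp y"
    using 1 assms by (intro add_mono mult_left_mono) auto
  finally show "exp ((1 - t) * x + t * y) \<le> (1 - t) * exp x + t * exp y" by (simp add: m_def)
  assume eq: "exp ((1 - t) * x + t * y) = (1 - t) * exp x + t * exp y"
  show "x = y"
  proof (rule ccontr)
    assume "x \<noteq> y"
    have "y - m = (1 - t) * (y - x)" by (simp add: m_def algebra_simps)
    hence "y - m \<noteq> 0" using \<open>x \<noteq> y\<close> assms by simp
    have "1 + (y - m) \<noteq> exp (y - m)"
    proof
      assume "1 + (y - m) = exp (y - m)"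
      hence "ln (exp (y - m)) = exp (y - m) - 1" by simp
      hence "exp (y - m) = 1" by (rule ln_eq_minus_one[OF exp_gt_zero])
      thus False using \<open>y - m \<noteq> 0\<close> by simp
    qed
    hence "1 + (y - m) < exp (y - m)"
      using exp_ge_add_one_self[of "y - m"] by linarith
    hence 2: "exp m * (1 + (y - m)) < exp y" by (simp add: exp_diff field_simps)
    have "exp m = (1 - t) * (exp m * (1 + (x - m))) + t * (exp m * (1 + (y - m)))"
      by (simp add: m_def algebra_simps)
    also have "\<dots> < (1 - t) * exp x + t * exp y"
      using 1 2 assms by (intro add_le_less_mono mult_left_mono mult_strict_left_mono) auto
    finally show False using eq by (simp add: m_def)
  qed
qed

text \<open>The exponents \<open>1 + r\<close> and \<open>1 + 1 / r\<close> are conjugate. For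
  positive numbers the claim is \<open>weighted_exp_mean\<close> in logarithmic coordinates; if one
  of the numbers is 0, equality forces the other to vanish as well, in agreement with
  \<open>0 powr r = 0\<close>.\<close>

lemma young_powr:
  fixes a b r :: real
  assumes "0 \<le> a" "0 \<le> b" "0 < r"
  shows "a * b \<le> a powr (1 + r) / (1 + r) + b powr (1 + 1 / r) / (1 + 1 / r)" (is "_ \<le> ?R")
    and "a * b = a powr (1 + r) / (1 + r) + b powr (1 + 1 / r) / (1 + 1 / r) \<Longrightarrow> b = a powr r"
proof -
  have *: "a * b \<le> ?R \<and> (a * b = ?R \<longrightarrow> b = a powr r)"
  proof (cases "a = 0 \<or> b = 0")
    case True
    moreover have "1 + r > 0" "1 + 1 / r > 0" using assms(3) by (simp_all add: add_pos_pos)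
    ultimately show ?thesis using assms by auto
  next
    case False
    hence pos: "a > 0" "b > 0" using assms by auto
    define t where "t = r / (1 + r)"
    have t: "0 < t" "t < 1" "1 - t = 1 / (1 + r)" "t = 1 / (1 + 1 / r)"
      using assms(3) by (auto simp: t_def field_simps)
    define x where "x = (1 + r) * ln a"
    define y where "y = (1 + 1 / r) * ln b"
    have xy: "(1 - t) * x + t * y = ln a + ln b"
    proof -
      have "1 + 1 / r = (1 + r) / r" using assms(3) by (simp add: field_simps)
      hence "t * (1 + 1 / r) = 1" using assms(3) by (simp add: t_def)
      hence "t * y = ln b" unfolding y_def by (metis mult.assoc mult_1)
      moreover have "(1 - t) * x = ln a" unfolding t(3) x_def using assms(3) by simp
      ultimately show ?thesis by simp
    qed
    have e: "exp x = a powr (1 + r)" "exp y = b powr (1 + 1 / r)"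
      using pos by (auto simp: x_def y_def powr_def)
    have ab: "exp (ln a + ln b) = a * b" using pos by (simp add: exp_add)
    have R: "?R = (1 - t) * exp x + t * exp y" unfolding e t(3) using t(4) by simp
    have "b = a powr r" if "x = y"
    proof -
      have "(1 + r) * (r * ln a) = (1 + r) * ln b"
        using that assms(3) by (simp add: x_def y_def field_simps)
      hence "ln b = r * ln a" using assms(3) by simp
      thus ?thesis using pos by (metis exp_ln powr_def less_irrefl)
    qed
    thus ?thesis using weighted_exp_mean[OF t(1,2), of x y] unfolding xy ab R by blast
  qed
  show "a * b \<le> ?R" using * by blast
  show "a * b = ?R \<Longrightarrow> b = a powr r" using * by blast
qed

text \<open>The difference of the two sides is the sum of the scalar gaps of
  \<open>young_powr\<close> over pairs of eigenvalues, weighted by the doubly stochastic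
  \<open>P\<close>. If it vanishes, then \<open>n i powr r = s j\<close> wherever
  \<open>P i j\<close> is nonzero, and this is the criterion of \<open>spectral_eq_iff\<close> for
  \<open>S = mat_powr N r\<close>.\<close>

lemma young_trace:
  assumes N: "hermitian_psd N" and S: "hermitian_psd S" and r: "0 < r"
  shows "tr_prod N S \<le> trace_powr N (1 + r) / (1 + r) + trace_powr S (1 + 1 / r) / (1 + 1 / r)" (is "_ \<le> ?R")
    and "tr_prod N S = trace_powr N (1 + r) / (1 + r) + trace_powr S (1 + 1 / r) / (1 + 1 / r) \<Longrightarrow>
      S = mat_powr N r"
proof -
  obtain V n where V: "unitary V" "\<And>i. 0 \<le> n i" "N = spectral V n" using psd_spectral[OF N] by blast
  obtain U s where U: "unitary U" "\<And>i. 0 \<le> s i" "S = spectral U s" using psd_spectral[OF S] by blast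
  define P where "P = (\<lambda>i j. (cmod ((conj_transpose V ** U) $ i $ j))\<^sup>2)"
  have W: "unitary (conj_transpose V ** U)" using U V by (simp add: unitary_mult unitary_conj_transpose)
  have P: "P i j \<ge> 0" "(\<Sum>i\<in>UNIV. P i j) = 1" "(\<Sum>j\<in>UNIV. P i j) = 1" for i j
    using unitary_column_norm[OF W] unitary_row_norm[OF W] by (simp_all add: P_def)
  define gap where "gap = (\<lambda>i j. n i powr (1 + r) / (1 + r) + s j powr (1 + 1 / r) / (1 + 1 / r) - n i * s j)"
  have gap: "gap i j \<ge> 0" for i j using young_powr(1)[OF V(2) U(2) r] by (simp add: gap_def)
  have "?R = (\<Sum>i\<in>UNIV. n i powr (1 + r) / (1 + r) * (\<Sum>j\<in>UNIV. P i j)) +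
      (\<Sum>j\<in>UNIV. s j powr (1 + 1 / r) / (1 + 1 / r) * (\<Sum>i\<in>UNIV. P i j))"
    using U V by (simp add: P trace_powr_spectral sum_divide_distrib)
  also have "\<dots> = (\<Sum>i\<in>UNIV. \<Sum>j\<in>UNIV. n i powr (1 + r) / (1 + r) * P i j) +
      (\<Sum>i\<in>UNIV. \<Sum>j\<in>UNIV. s j powr (1 + 1 / r) / (1 + 1 / r) * P i j)"
    unfolding sum_distrib_left by (subst (2) sum.swap) simp
  finally have diff: "?R - tr_prod N S = (\<Sum>i\<in>UNIV. \<Sum>j\<in>UNIV. gap i j * P i j)"
    unfolding V(3) U(3) tr_prod_spectral gap_def
    by (simp add: P_def algebra_simps sum.distrib sum_subtractf)
  show "tr_prod N S \<le> ?R"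
    using diff gap P(1) by (smt (verit) sum_nonneg mult_nonneg_nonneg)
  assume "tr_prod N S = ?R"
  hence 0: "(\<Sum>i\<in>UNIV. \<Sum>j\<in>UNIV. gap i j * P i j) = 0" using diff by simp
  have "(\<Sum>j\<in>UNIV. gap i j * P i j) = 0" for i
    using 0 by (subst (asm) sum_nonneg_eq_0_iff) (auto intro!: sum_nonneg simp: gap P)
  hence 1: "gap i j * P i j = 0" for i j
    by (subst (asm) sum_nonneg_eq_0_iff) (auto simp: gap P)
  have "(conj_transpose V ** U) $ i $ j = 0 \<or> n i powr r = s j" for i j
  proof (cases "P i j = 0")
    case False
    hence "gap i j = 0" using 1[of i j] by simp
    hence "n i * s j = n i powr (1 + r) / (1 + r) + s j powr (1 + 1 / r) / (1 + 1 / r)"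
      by (simp add: gap_def)
    thus ?thesis using young_powr(2)[OF V(2) U(2) r] by metis
  qed (simp add: P_def)
  hence "spectral U s = spectral V (\<lambda>i. n i powr r)"
    using spectral_eq_iff[OF U(1) V(1)] by blast
  thus "S = mat_powr N r" using U V by (simp add: mat_powr_spectral)
qed

text \<open>Young's inequality is an equality for \<open>S\<close> and \<open>S\<^sup>1\<^sup>/\<^sup>r\<close>, so the trace power is a supremum
  of affine functions.\<close>

lemma trace_powr_convex:
  assumes S: "hermitian_psd S0" "hermitian_psd S1" and t: "0 \<le> t" "t \<le> 1" and r: "0 < r"
  shows "trace_powr ((1 - t) *\<^sub>R S0 + t *\<^sub>R S1) (1 + 1 / r) \<le>
    (1 - t) * trace_powr S0 (1 + 1 / r) + t * trace_powr S1 (1 + 1 / r)"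
proof -
  let ?S = "(1 - t) *\<^sub>R S0 + t *\<^sub>R S1"
  define p where "p = 1 + 1 / r"
  \<comment> \<open>\<open>Y\<close> makes Young's inequality tight at \<open>?S\<close>: both
    \<open>tr_prod Y ?S\<close> and \<open>trace_powr Y (1 + r)\<close> equal
    \<open>trace_powr ?S p\<close>. Since \<open>tr_prod Y\<close> is linear, the bounds at
    \<open>S0\<close> and \<open>S1\<close> can be averaged.\<close>
  define Y where "Y = mat_powr ?S (1 / r)"
  have psd: "hermitian_psd ?S" using S t by (auto intro!: hermitian_psd_add hermitian_psd_scaleR)
  have Y: "hermitian_psd Y" unfolding Y_def using psd by (rule hermitian_psd_mat_powr)
  have c: "1 / r * (1 + r) = p" "1 / r + 1 = p" "1 / (1 + r) = 1 - 1 / p" "p > 0"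
    using r by (auto simp: p_def field_simps add_pos_pos)
  have YS: "tr_prod Y ?S = trace_powr ?S p"
    using tr_prod_mat_powr[OF psd, of "1 / r" 1] by (simp add: mat_powr_1[OF psd] Y_def c)
  have Y1: "trace_powr Y (1 + r) = trace_powr ?S p"
    unfolding Y_def trace_powr_mat_powr[OF psd] c ..
  have y: "tr_prod Y S \<le> trace_powr ?S p * (1 - 1 / p) + trace_powr S p / p" if "hermitian_psd S" for S
    using young_trace(1)[OF Y that r] unfolding Y1 p_def[symmetric] by (simp flip: c(3))
  have "trace_powr ?S p = (1 - t) * tr_prod Y S0 + t * tr_prod Y S1"
    unfolding YS[symmetric] by (simp add: tr_prod_add_right tr_prod_scaleR_right)
  also have "\<dots> \<le> (1 - t) * (trace_powr ?S p * (1 - 1 / p) + trace_powr S0 p / p) +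
      t * (trace_powr ?S p * (1 - 1 / p) + trace_powr S1 p / p)"
    using t S y by (intro add_mono mult_left_mono) auto
  also have "\<dots> = trace_powr ?S p - trace_powr ?S p / p +
      ((1 - t) * trace_powr S0 p + t * trace_powr S1 p) / p"
    by (simp add: algebra_simps add_divide_distrib diff_divide_distrib)
  finally have "trace_powr ?S p / p \<le> ((1 - t) * trace_powr S0 p + t * trace_powr S1 p) / p" by simp
  thus ?thesis using c(4) by (simp add: divide_le_cancel p_def)
qed

section \<open>The three lines theorem\<close>

text \<open>Entire functions suffice, because the only functions interpolated are finite sums of
  products of constants and powers with exponents affine in z.\<close>

definition strip_bounded :: "(complex \<Rightarrow> complex) \<Rightarrow> bool" where
  "strip_bounded f \<longleftrightarrow>
    f holomorphic_on UNIV \<and> (\<exists>C. \<forall>z. 0 \<le> Re z \<longrightarrow> Re z \<le> 1 \<longrightarrow> cmod (f z) \<le> C)"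

lemma strip_bounded_const: "strip_bounded (\<lambda>z. c)"
  by (auto simp: strip_bounded_def)

lemma strip_bounded_mult:
  assumes "strip_bounded f" "strip_bounded g" shows "strip_bounded (\<lambda>z. f z * g z)"
proof -
  obtain C D where CD: "\<And>z. 0 \<le> Re z \<Longrightarrow> Re z \<le> 1 \<Longrightarrow> cmod (f z) \<le> C"
    "\<And>z. 0 \<le> Re z \<Longrightarrow> Re z \<le> 1 \<Longrightarrow> cmod (g z) \<le> D"
    using assms by (auto simp: strip_bounded_def)
  have "cmod (f z * g z) \<le> C * D" if "0 \<le> Re z" "Re z \<le> 1" for z
    unfolding norm_mult using CD[OF that] by (intro mult_mono) (auto intro: order.trans[OF norm_ge_zero])
  thus ?thesis using assms by (auto simp: strip_bounded_def intro!: holomorphic_intros)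
qed

lemma strip_bounded_add:
  assumes "strip_bounded f" "strip_bounded g" shows "strip_bounded (\<lambda>z. f z + g z)"
proof -
  obtain C D where CD: "\<And>z. 0 \<le> Re z \<Longrightarrow> Re z \<le> 1 \<Longrightarrow> cmod (f z) \<le> C"
    "\<And>z. 0 \<le> Re z \<Longrightarrow> Re z \<le> 1 \<Longrightarrow> cmod (g z) \<le> D"
    using assms by (auto simp: strip_bounded_def)
  have "cmod (f z + g z) \<le> C + D" if "0 \<le> Re z" "Re z \<le> 1" for z
    using CD[OF that] norm_triangle_le add_mono by blast
  thus ?thesis using assms by (auto simp: strip_bounded_def intro!: holomorphic_intros)
qed

lemma strip_bounded_sum:
  "(\<And>i. i \<in> I \<Longrightarrow> strip_bounded (f i)) \<Longrightarrow> strip_bounded (\<lambda>z. \<Sum>i\<in>I. f i z)"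
  by (induction I rule: infinite_finite_induct) (auto simp: strip_bounded_const strip_bounded_add)

lemma norm_of_real_powr:
  assumes "0 \<le> a" shows "cmod (of_real a powr z) = a powr Re z"
  using assms by (simp add: norm_powr_real_powr)

text \<open>A positive base gives the exponential of an affine function, whose modulus depends on
  \<open>Re z\<close> alone. Base 0 gives the constant 0, since \<open>0 powr z = 0\<close> for
  every z.\<close>

lemma strip_bounded_powr:
  fixes a u v :: real
  assumes "0 \<le> a"
  shows "strip_bounded (\<lambda>z. of_real a powr (of_real u + of_real v * z))"
proof (cases "a = 0")
  case False
  hence a: "a > 0" using assms by simp
  have "cmod (of_real a powr (of_real u + of_real v * z)) \<le> exp ((\<bar>u\<bar> + \<bar>v\<bar>) * \<bar>ln a\<bar>)"
    if "0 \<le> Re z" "Re z \<le> 1" for z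
  proof -
    have "(u + v * Re z) * ln a \<le> \<bar>u + v * Re z\<bar> * \<bar>ln a\<bar>"
      by (metis abs_ge_self abs_mult)
    also have "\<bar>v * Re z\<bar> \<le> \<bar>v\<bar> * 1" unfolding abs_mult using that by (intro mult_left_mono) auto
    hence "\<bar>u + v * Re z\<bar> * \<bar>ln a\<bar> \<le> (\<bar>u\<bar> + \<bar>v\<bar>) * \<bar>ln a\<bar>" by (intro mult_right_mono) auto
    finally show ?thesis using a by (simp add: norm_of_real_powr powr_def)
  qed
  moreover have "(\<lambda>z. of_real a powr (of_real u + of_real v * z)) holomorphic_on UNIV"
    using a unfolding powr_def by (auto intro!: holomorphic_intros)
  ultimately show ?thesis unfolding strip_bounded_def by blast
qed (simp add: strip_bounded_const)

text \<open>The factor \<open>exp (\<epsilon> (z\<^sup>2 - 1))\<close> decays as the imaginary part grows, so the maximum modulus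
  principle applies on a large rectangle.\<close>

lemma three_lines_unit_bound:
  assumes f: "strip_bounded f"
    and b0: "\<And>z. Re z = 0 \<Longrightarrow> cmod (f z) \<le> 1"
    and b1: "\<And>z. Re z = 1 \<Longrightarrow> cmod (f z) \<le> 1"
    and z: "0 \<le> Re z" "Re z \<le> 1"
  shows "cmod (f z) \<le> 1"
proof -
  obtain C where C: "\<And>z. 0 \<le> Re z \<Longrightarrow> Re z \<le> 1 \<Longrightarrow> cmod (f z) \<le> C"
    and hol: "f holomorphic_on UNIV"
    using f by (auto simp: strip_bounded_def)
  have C0: "C \<ge> 0" using C[of 0] order.trans[OF norm_ge_zero] by auto
  have main: "cmod (f z) \<le> exp (\<epsilon> * (1 - Re (z\<^sup>2)))" if e: "\<epsilon> > 0" for \<epsilon>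
  proof -
    define h where "h = (\<lambda>z. f z * exp (of_real \<epsilon> * (z\<^sup>2 - 1)))"
    have hn: "cmod (h w) = cmod (f w) * exp (\<epsilon> * ((Re w)\<^sup>2 - (Im w)\<^sup>2 - 1))" for w
      by (simp add: h_def norm_mult power2_eq_square)
    \<comment> \<open>The rectangle contains \<open>z\<close>, and \<open>\<epsilon> * R * R\<close>
      is at least \<open>C\<close>. On the horizontal edges the damping then leaves at most
      \<open>C * exp (- C)\<close>, which is at most 1.\<close>
    define R where "R = \<bar>Im z\<bar> + C / \<epsilon> + 1"
    have R: "R \<ge> 1" "R \<ge> \<bar>Im z\<bar>" "\<epsilon> * R \<ge> C"
      using e C0 by (auto simp: R_def field_simps)
    define S where "S = cbox (Complex 0 (-R)) (Complex 1 R)"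
    have "cmod (h z) \<le> 1"
    proof (rule maximum_modulus_frontier[of h S])
      show "h holomorphic_on interior S" "continuous_on (closure S) h"
        unfolding h_def
        by (auto intro!: holomorphic_intros holomorphic_on_imp_continuous_on holomorphic_on_subset[OF hol])
      show "bounded S" by (simp add: S_def bounded_cbox)
      show "z \<in> S" using z R by (auto simp: S_def in_cbox_complex_iff)
    next
      fix w assume "w \<in> frontier S"
      hence "w \<in> S - interior S" unfolding S_def frontier_def by simp
      hence w: "w \<in> S" "w \<notin> box (Complex 0 (-R)) (Complex 1 R)" by (auto simp: S_def interior_cbox)
      have re: "0 \<le> Re w" "Re w \<le> 1" using w(1) by (auto simp: S_def in_cbox_complex_iff)
      have sq: "(Re w)\<^sup>2 \<le> 1" using re by (simp add: power_le_one)
      have "Re w = 0 \<or> Re w = 1 \<or> Im w = R \<or> Im w = -R"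
        using w by (auto simp: S_def in_cbox_complex_iff in_box_complex_iff)
      then consider "cmod (f w) \<le> 1" | "(Im w)\<^sup>2 = R\<^sup>2" using b0 b1 by auto
      thus "cmod (h w) \<le> 1"
      proof cases
        case 1
        have "\<epsilon> * ((Re w)\<^sup>2 - (Im w)\<^sup>2 - 1) \<le> 0"
          using e sq by (intro mult_nonneg_nonpos) (use zero_le_power2[of "Im w"] in linarith)+
        thus ?thesis unfolding hn using 1 by (intro mult_le_one) auto
      next
        case 2
        have "\<epsilon> * ((Re w)\<^sup>2 - (Im w)\<^sup>2 - 1) \<le> \<epsilon> * (- (R\<^sup>2))"
          using e sq 2 by (intro mult_left_mono) auto
        also have "\<epsilon> * (- (R\<^sup>2)) \<le> - C"
        proof -
          have "C * 1 \<le> (\<epsilon> * R) * R" using R C0 by (intro mult_mono) auto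
          thus ?thesis by (simp add: power2_eq_square mult_ac)
        qed
        finally have "exp (\<epsilon> * ((Re w)\<^sup>2 - (Im w)\<^sup>2 - 1)) \<le> exp (- C)" by simp
        hence "cmod (h w) \<le> C * exp (- C)"
          unfolding hn using C[OF re] C0 by (intro mult_mono) auto
        also have "\<dots> \<le> 1" using exp_ge_add_one_self[of C] by (simp add: exp_minus field_simps)
        finally show ?thesis .
      qed
    qed
    moreover define a where "a = \<epsilon> * (1 - Re (z\<^sup>2))"
    have "\<epsilon> * ((Re z)\<^sup>2 - (Im z)\<^sup>2 - 1) = - a" by (simp add: a_def power2_eq_square algebra_simps)
    ultimately have "cmod (f z) * exp (- a) \<le> 1" unfolding hn by simp
    hence "cmod (f z) \<le> exp a" by (simp add: exp_minus field_simps)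
    thus ?thesis by (simp add: a_def)
  qed
  \<comment> \<open>Letting \<epsilon> tend to 0 from the right removes the damping factor.\<close>
  have "((\<lambda>\<epsilon>. exp (\<epsilon> * (1 - Re (z\<^sup>2)))) \<longlongrightarrow> exp (0 * (1 - Re (z\<^sup>2)))) (at_right 0)"
    by (intro tendsto_intros)
  hence "cmod (f z) \<le> exp (0 * (1 - Re (z\<^sup>2)))"
  proof (rule tendsto_lowerbound)
    show "\<forall>\<^sub>F \<epsilon> in at_right 0. cmod (f z) \<le> exp (\<epsilon> * (1 - Re (z\<^sup>2)))"
      using eventually_at_right_less[of "0 :: real"] by (rule eventually_mono) (rule main)
  qed simp
  thus ?thesis by simp
qed

text \<open>The factor \<open>M powr (z - 1)\<close> has modulus \<open>1 / M\<close> on the left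
  edge and 1 on the right edge, so it reduces the claim to the bound 1 on both edges.\<close>

lemma three_lines:
  assumes f: "strip_bounded f" and M: "M > 0"
    and b0: "\<And>z. Re z = 0 \<Longrightarrow> cmod (f z) \<le> M"
    and b1: "\<And>z. Re z = 1 \<Longrightarrow> cmod (f z) \<le> 1"
    and t: "0 \<le> t" "t \<le> 1"
  shows "cmod (f (of_real t)) \<le> M powr (1 - t)"
proof -
  define g where "g = (\<lambda>z. f z * of_real M powr (of_real (-1) + of_real 1 * z))"
  have g: "cmod (g z) = cmod (f z) * M powr (Re z - 1)" for z
    using M by (simp add: g_def norm_mult norm_of_real_powr)
  have "cmod (g (of_real t)) \<le> 1"
  proof (rule three_lines_unit_bound[of g])
    show "strip_bounded g" unfolding g_def using f M
      by (intro strip_bounded_mult strip_bounded_powr) auto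
    show "cmod (g z) \<le> 1" if "Re z = 0" for z
      using b0[OF that] M that by (simp add: g powr_minus_divide)
    show "cmod (g z) \<le> 1" if "Re z = 1" for z
      using b1[OF that] M that by (simp add: g)
  qed (use t in auto)
  hence "cmod (f (of_real t)) * M powr (t - 1) * M powr (1 - t) \<le> 1 * M powr (1 - t)"
    unfolding g by (intro mult_right_mono) auto
  thus ?thesis using M by (simp add: mult.assoc flip: powr_add)
qed

section \<open>Interpolation of the trace functionals\<close>

text \<open>A Cauchy-Schwarz inequality with the arithmetic mean: the form is nonnegative at
  \<open>\<omega> *s x - y\<close>, where the phase \<omega> turns both cross terms into
  \<open>- cmod z\<close>. It controls mixed terms, evaluated at a point and at its conjugate, by
  the quadratic form alone.\<close>

lemma norm_cip_psd_le:
  assumes B: "hermitian_psd B"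
  shows "cmod (cip x (B *v y)) \<le> (x \<bullet> (B *v x) + y \<bullet> (B *v y)) / 2"
proof -
  define z where "z = cip x (B *v y)"
  define \<omega> where "\<omega> = (if z = 0 then 1 else z / of_real (cmod z))"
  have w: "cnj \<omega> * z = of_real (cmod z)" "\<omega> * cnj \<omega> = 1"
  proof -
    have "cmod \<omega> = 1" by (simp add: \<omega>_def norm_divide)
    thus "\<omega> * cnj \<omega> = 1" using complex_norm_square[of \<omega>] by simp
    have "cnj z * z = of_real (cmod z) * of_real (cmod z)"
      using complex_norm_square[of z] by (simp add: power2_eq_square mult.commute)
    thus "cnj \<omega> * z = of_real (cmod z)" by (simp add: \<omega>_def)
  qed
  have herm: "hermitian B" using B by (simp add: hermitian_psd_def)
  have "cip y (B *v x) = cnj z" unfolding z_def cnj_cip by (rule cip_hermitian[OF herm])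
  hence "cip (\<omega> *s x - y) (B *v (\<omega> *s x - y)) =
      (\<omega> * cnj \<omega>) * cip x (B *v x) - cnj \<omega> * z - cnj (cnj \<omega> * z) + cip y (B *v y)"
    by (simp add: matrix_vector_mult_diff_distrib vector_scalar_commute cip_simps z_def algebra_simps)
  hence "cip (\<omega> *s x - y) (B *v (\<omega> *s x - y)) =
      cip x (B *v x) - of_real (2 * cmod z) + cip y (B *v y)"
    unfolding w by simp
  hence "(\<omega> *s x - y) \<bullet> (B *v (\<omega> *s x - y)) = x \<bullet> (B *v x) - 2 * cmod z + y \<bullet> (B *v y)"
    unfolding Re_cip[symmetric] by simp
  moreover have "0 \<le> (\<omega> *s x - y) \<bullet> (B *v (\<omega> *s x - y))" using B by (simp add: hermitian_psd_inner)
  ultimately show ?thesis unfolding z_def[symmetric] by simp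
qed

lemma matrix_mult_add_left: "(A + B) ** C = A ** C + B ** (C :: 'a::semiring_1^'n^'m)"
  by (simp add: matrix_matrix_mult_def vec_eq_iff algebra_simps sum.distrib)

text \<open>Write N for \<open>real_diag n\<close> and S for \<open>spectral T s\<close>. The entire
  function \<open>F\<close> is the sum over j of x_j^(p (1 - z)) Tr (B_j N^(b z) S^(p z) N^(b z)).
  Its modulus is at most \<open>M\<close> on the line Re z = 0 and at most 1 on the line Re z = 1,
  and its real part at z = 1 / p is the left-hand side.\<close>

lemma interpolation_diagonal:
  fixes B :: "'n::finite \<Rightarrow> complex^'d^'d"
  assumes B: "\<And>j. hermitian_psd (B j)" and sumB: "(\<Sum>j\<in>UNIV. B j) = real_diag n"
    and n: "\<And>k. 0 < n k" and T: "unitary T" and s: "\<And>k. 0 \<le> s k"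
    and r: "0 < r" and p: "p = 1 + 1 / r"
    and s1: "(\<Sum>k\<in>UNIV. s k powr p) \<le> 1" and x: "\<And>j. 0 \<le> x j"
    and M: "M = (\<Sum>j\<in>UNIV. x j powr p * tr_prod (B j) (real_diag (\<lambda>k. n k powr r)))" "0 < M"
  shows "(\<Sum>j\<in>UNIV. x j powr (p - 1) * tr_prod (B j) (spectral T s)) \<le> M powr (1 - 1 / p)"
proof -
  have p0: "p > 1" using r p by simp
  \<comment> \<open>The real part of the exponent is \<open>r / 2\<close> where Re z = 0 and
    \<open>- 1 / 2\<close> where Re z = 1; the exponent vanishes at z = 1 / p because
    \<open>r * p = 1 + r\<close>.\<close>
  define b where "b = (\<lambda>z :: complex. of_real (r / 2) + of_real (- (1 + r) / 2) * z)"
  define Y :: "complex \<Rightarrow> complex^'d^'d" where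
    "Y = (\<lambda>z. \<chi> k m. of_real (n k) powr b z * T $ k $ m)"
  define y where "y = (\<lambda>z m. Y z *v axis m 1)"
  \<comment> \<open>Written out in entries, and with summands such as \<open>of_real 0\<close>, so
    that it has the shape required by the closure rules of \<open>strip_bounded\<close>.\<close>
  define F where "F = (\<lambda>z. \<Sum>j\<in>UNIV. of_real (x j) powr (of_real p + of_real (- p) * z) *
    (\<Sum>m\<in>UNIV. of_real (s m) powr (of_real 0 + of_real p * z) * 
      (\<Sum>k\<in>UNIV. \<Sum>l\<in>UNIV. of_real (n k) powr b z * cnj (T $ k $ m) * (B j $ k $ l) *
         (of_real (n l) powr b z * T $ l $ m))))"
  have sb: "strip_bounded F"
    unfolding F_def b_def
    by (intro strip_bounded_sum strip_bounded_mult strip_bounded_const strip_bounded_powr)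
       (use x s n in \<open>auto intro: less_imp_le\<close>)
  have y_nth: "y z m $ k = of_real (n k) powr b z * T $ k $ m" for z m k
    by (simp add: y_def Y_def matrix_vector_mult_def axis_def if_distrib cong: if_cong)
  \<comment> \<open>Evaluating the first argument of \<open>cip\<close> at the conjugate point
    undoes its conjugate-linearity; this keeps \<open>F\<close> holomorphic.\<close>
  have cnj_y: "cnj (y (cnj z) m $ k) = of_real (n k) powr b z * cnj (T $ k $ m)" for z m k
  proof -
    have "cnj (of_real (n k) powr b (cnj z)) = of_real (n k) powr b z"
      using n[of k] by (simp add: b_def powr_def exp_cnj Ln_of_real)
    thus ?thesis by (simp add: y_nth)
  qed
  have F: "F z = (\<Sum>j\<in>UNIV. of_real (x j) powr (of_real p + of_real (- p) * z) *
    (\<Sum>m\<in>UNIV. of_real (s m) powr (of_real 0 + of_real p * z) * cip (y (cnj z) m) (B j *v y z m)))" for z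
    unfolding F_def cip_def cnj_y matrix_vector_mult_def
    by (simp add: y_nth sum_distrib_left mult.assoc)
  define q where "q = (\<lambda>z j m. y z m \<bullet> (B j *v y z m))"
  have cb: "cmod (cip (y (cnj z) m) (B j *v y z m)) \<le> (q (cnj z) j m + q z j m) / 2" for z m j
    unfolding q_def by (rule norm_cip_psd_le[OF B])
  have Fb: "cmod (F z) \<le> (\<Sum>j\<in>UNIV. x j powr (p - p * Re z) *
      (\<Sum>m\<in>UNIV. s m powr (p * Re z) * ((q (cnj z) j m + q z j m) / 2)))" for z
  proof -
    have 1: "cmod (of_real (s m) powr (of_real 0 + of_real p * z) * cip (y (cnj z) m) (B j *v y z m)) \<le>
        s m powr (p * Re z) * ((q (cnj z) j m + q z j m) / 2)" for j m
    proof -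
      have "cmod (of_real (s m) powr (of_real 0 + of_real p * z) * cip (y (cnj z) m) (B j *v y z m)) =
          s m powr (p * Re z) * cmod (cip (y (cnj z) m) (B j *v y z m))"
        by (simp add: norm_mult norm_of_real_powr s)
      also have "\<dots> \<le> s m powr (p * Re z) * ((q (cnj z) j m + q z j m) / 2)"
        by (intro mult_left_mono cb) simp
      finally show ?thesis .
    qed
    have 2: "cmod (of_real (x j) powr (of_real p + of_real (- p) * z) * c) = x j powr (p - p * Re z) * cmod c" for j c
      by (simp add: norm_mult norm_of_real_powr x)
    show ?thesis unfolding F
      by (rule sum_norm_le) (unfold 2, intro mult_left_mono sum_norm_le 1, simp)
  qed
  \<comment> \<open>On the left edge the imaginary part of the exponent contributes only phases, so
    \<open>Y z ** conj_transpose (Y z)\<close> is the \<open>r\<close>-th power of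
    \<open>real_diag n\<close>.\<close>
  have q0: "(\<Sum>m\<in>UNIV. q z j m) = tr_prod (B j) (real_diag (\<lambda>k. n k powr r))" if "Re z = 0" for z j
  proof -
    have "Y z ** conj_transpose (Y z) = real_diag (\<lambda>k. n k powr r)"
    proof -
      have "(Y z ** conj_transpose (Y z)) $ k $ l = real_diag (\<lambda>k. n k powr r) $ k $ l" for k l
      proof -
        have "(Y z ** conj_transpose (Y z)) $ k $ l =
            of_real (n k) powr b z * cnj (of_real (n l) powr b z) * (T ** conj_transpose T) $ k $ l"
          by (simp add: Y_def matrix_matrix_mult_def conj_transpose_def sum_distrib_left mult_ac)
        moreover have "of_real (n k) powr b z * cnj (of_real (n k) powr b z) = of_real (n k powr r)"
        proof -
          have "Re (b z) = r / 2" using that by (simp add: b_def)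
          hence "cmod (of_real (n k) powr b z) = n k powr (r / 2)"
            by (simp only: norm_of_real_powr[OF less_imp_le[OF n]])
          hence "(cmod (of_real (n k) powr b z))\<^sup>2 = n k powr r"
            by (simp add: power2_eq_square flip: powr_add)
          thus ?thesis by (metis complex_norm_square)
        qed
        ultimately show ?thesis using T by (cases "k = l") (simp_all add: unitary_def mat_def real_diag_def)
      qed
      thus ?thesis by (simp add: vec_eq_iff)
    qed
    moreover have "trace (B j ** (Y z ** conj_transpose (Y z))) = trace (conj_transpose (Y z) ** B j ** Y z)"
      by (metis matrix_mul_assoc trace_mul_sym)
    moreover have "(\<Sum>m\<in>UNIV. q z j m) = Re (trace (conj_transpose (Y z) ** B j ** Y z))"
      by (simp add: q_def y_def trace_def conjugate_diag_entry)
    ultimately show ?thesis by (simp add: tr_prod_def)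
  qed
  \<comment> \<open>On the right edge the squared modulus of the rescaling is
    \<open>1 / n k\<close>. It cancels the eigenvalues of the sum of the \<open>B j\<close> and
    leaves the norm of a column of \<open>T\<close>.\<close>
  have q1: "(\<Sum>j\<in>UNIV. q z j m) = 1" if "Re z = 1" for z m
  proof -
    have "(\<Sum>j\<in>UNIV. q z j m) = y z m \<bullet> ((\<Sum>j\<in>UNIV. B j) *v y z m)"
    proof -
      have "(\<Sum>j\<in>UNIV. B j *v v) = (\<Sum>j\<in>UNIV. B j) *v v" for v
        by (simp add: vec_eq_iff matrix_vector_mult_def sum_distrib_right) (intro allI sum.swap)
      thus ?thesis by (simp add: q_def flip: inner_sum_right)
    qed
    also have "\<dots> = (\<Sum>k\<in>UNIV. (cmod (T $ k $ m))\<^sup>2)"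
      unfolding sumB real_diag_quadratic
    proof (rule sum.cong)
      fix k
      have "Re (b z) = - 1 / 2" using that by (simp add: b_def field_simps)
      hence "(n k) * (cmod (of_real (n k) powr b z))\<^sup>2 = 1"
        using n[of k] by (simp add: norm_of_real_powr power2_eq_square powr_minus_divide flip: powr_add)
      thus "n k * (cmod (y z m $ k))\<^sup>2 = (cmod (T $ k $ m))\<^sup>2"
        by (simp add: y_nth norm_mult power_mult_distrib flip: mult.assoc)
    qed simp
    also have "\<dots> = 1" by (rule unitary_column_norm[OF T])
    finally show ?thesis .
  qed
  have q_nn: "q z j m \<ge> 0" for z j m using B by (simp add: q_def hermitian_psd_inner)
  \<comment> \<open>Only an inequality, because \<open>0 powr 0 = 0\<close>.\<close>
  have le1: "a powr 0 \<le> (1::real)" for a by (cases "a = 0") auto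
  have "cmod (F (of_real (1 / p))) \<le> M powr (1 - 1 / p)"
  proof (rule three_lines[OF sb M(2)])
    fix z :: complex assume z: "Re z = 0"
    have "cmod (F z) \<le> (\<Sum>j\<in>UNIV. x j powr p * (\<Sum>m\<in>UNIV. s m powr 0 * ((q (cnj z) j m + q z j m) / 2)))"
      using Fb[of z] z by simp
    also have "\<dots> \<le> (\<Sum>j\<in>UNIV. x j powr p * (\<Sum>m\<in>UNIV. 1 * ((q (cnj z) j m + q z j m) / 2)))"
      by (intro sum_mono mult_left_mono mult_right_mono le1) (auto simp: q_nn)
    also have "\<dots> = M"
      using z by (simp add: M q0 sum.distrib flip: sum_divide_distrib)
    finally show "cmod (F z) \<le> M" .
  next
    fix z :: complex assume z: "Re z = 1"
    have "cmod (F z) \<le> (\<Sum>j\<in>UNIV. x j powr 0 * (\<Sum>m\<in>UNIV. s m powr p * ((q (cnj z) j m + q z j m) / 2)))"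
      using Fb[of z] z by simp
    also have "\<dots> \<le> (\<Sum>j\<in>UNIV. 1 * (\<Sum>m\<in>UNIV. s m powr p * ((q (cnj z) j m + q z j m) / 2)))"
      by (intro sum_mono mult_right_mono le1) (auto simp: q_nn intro!: sum_nonneg mult_nonneg_nonneg)
    also have "\<dots> = (\<Sum>m\<in>UNIV. s m powr p * (((\<Sum>j\<in>UNIV. q (cnj z) j m) + (\<Sum>j\<in>UNIV. q z j m)) / 2))"
      by (simp add: sum_distrib_left flip: sum.distrib sum_divide_distrib) (subst sum.swap, simp add: sum_distrib_left sum_divide_distrib)
    also have "\<dots> \<le> 1" using z s1 by (simp add: q1)
    finally show "cmod (F z) \<le> 1" .
  qed (use p0 in auto)
  moreover have "Re (F (of_real (1 / p))) = (\<Sum>j\<in>UNIV. x j powr (p - 1) * tr_prod (B j) (spectral T s))"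
  proof -
    have "r / 2 + - (1 + r) / 2 * (1 / p) = 0" using r by (simp add: p field_simps add_pos_pos)
    hence "b (of_real (1 / p)) = 0" unfolding b_def by (metis of_real_0 of_real_add of_real_mult)
    hence Y1: "Y (of_real (1 / p)) = T" using n by (simp add: Y_def vec_eq_iff less_imp_neq[symmetric])
    have c: "Re (cip (y (of_real (1 / p)) m) (B j *v y (of_real (1 / p)) m)) =
        Re ((conj_transpose T ** B j ** T) $ m $ m)" for j m
      by (simp add: y_def Y1 Re_cip conjugate_diag_entry del: of_real_divide)
    have e: "of_real (x j) powr (of_real p + of_real (- p) * of_real (1 / p)) = complex_of_real (x j powr (p - 1))"
      "of_real (s m) powr (of_real 0 + of_real p * of_real (1 / p)) = complex_of_real (s m)" for j m
      using p0 x[of j] s[of m] by (simp_all add: powr_of_real[symmetric])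
    have "Re (F (of_real (1 / p))) = (\<Sum>j\<in>UNIV. x j powr (p - 1) *
        (\<Sum>m\<in>UNIV. s m * Re (cip (y (of_real (1 / p)) m) (B j *v y (of_real (1 / p)) m))))"
      unfolding F e complex_cnj_complex_of_real by (simp del: of_real_divide)
    thus ?thesis unfolding c tr_prod_spectral_right .
  qed
  ultimately show ?thesis using complex_Re_le_cmod order.trans by metis
qed

text \<open>Complex interpolation, between exponents \<open>\<infinity>\<close> and \<open>1\<close>, of the map from \<open>S\<close> to the numbers
  \<open>tr_prod (B j) S\<close>.\<close>

lemma interpolation:
  fixes B :: "'n::finite \<Rightarrow> complex^'d^'d"
  assumes B: "\<And>j. hermitian_psd (B j)" and V: "unitary V"
    and sumB: "(\<Sum>j\<in>UNIV. B j) = spectral V n" and n: "\<And>k. 0 < n k"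
    and S: "hermitian_psd S" and r: "0 < r" and p: "p = 1 + 1 / r"
    and S1: "trace_powr S p \<le> 1" and x: "\<And>j. 0 \<le> x j"
    and M: "M = (\<Sum>j\<in>UNIV. x j powr p * tr_prod (B j) (mat_powr (\<Sum>j\<in>UNIV. B j) r))" "0 < M"
  shows "(\<Sum>j\<in>UNIV. x j powr (p - 1) * tr_prod (B j) S) \<le> M powr (1 - 1 / p)"
proof -
  obtain U s where U: "unitary U" "\<And>i. 0 \<le> s i" "S = spectral U s" using psd_spectral[OF S] by blast
  \<comment> \<open>Passing to the eigenbasis of the sum of the \<open>B j\<close> makes that sum
    diagonal and leaves all trace pairings unchanged.\<close>
  define B' where "B' = (\<lambda>j. conj_transpose V ** B j ** V)"
  define T where "T = conj_transpose V ** U"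
  have vv: "conj_transpose V ** V = mat 1" "V ** conj_transpose V = mat 1" using V by (auto simp: unitary_def)
  have T: "unitary T" unfolding T_def using U V by (simp add: unitary_mult unitary_conj_transpose)
  have tr: "tr_prod (B' j) (spectral T s) = tr_prod (B j) S" for j
  proof -
    have "conj_transpose T ** B' j ** T = conj_transpose U ** (V ** conj_transpose V) ** B j ** (V ** conj_transpose V) ** U"
      by (simp add: T_def B'_def conj_transpose_mult matrix_mul_assoc)
    hence "conj_transpose T ** B' j ** T = conj_transpose U ** B j ** U" by (simp add: vv)
    thus ?thesis unfolding U(3) tr_prod_spectral_right by simp
  qed
  have td: "tr_prod (B' j) (real_diag l) = tr_prod (B j) (spectral V l)" for j l
    unfolding tr_prod_spectral_right B'_def
    by (simp add: tr_prod_def trace_def real_diag_mult_right mult.commute)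
  have sumB': "(\<Sum>j\<in>UNIV. B' j) = real_diag n"
  proof -
    have "(\<Sum>j\<in>UNIV. B' j) = conj_transpose V ** (\<Sum>j\<in>UNIV. B j) ** V"
      unfolding B'_def
      by (induction rule: finite_induct[OF finite[of UNIV]]) (auto simp: matrix_add_ldistrib matrix_mult_add_left)
    also have "\<dots> = (conj_transpose V ** V) ** real_diag n ** (conj_transpose V ** V)"
      unfolding sumB spectral_def by (simp add: matrix_mul_assoc)
    finally show ?thesis by (simp add: vv)
  qed
  have "(\<Sum>j\<in>UNIV. x j powr (p - 1) * tr_prod (B' j) (spectral T s)) \<le> M powr (1 - 1 / p)"
  proof (rule interpolation_diagonal[OF _ sumB' n T U(2) r p _ x])
    show "hermitian_psd (B' j)" for j unfolding B'_def by (rule hermitian_psd_conjugate[OF B])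
    show "(\<Sum>k\<in>UNIV. s k powr p) \<le> 1" using S1 U by (simp add: trace_powr_spectral)
    show "M = (\<Sum>j\<in>UNIV. x j powr p * tr_prod (B' j) (real_diag (\<lambda>k. n k powr r)))"
      unfolding td M(1) sumB mat_powr_spectral[OF V] ..
  qed (rule M)
  thus ?thesis by (simp add: tr)
qed

section \<open>Optimal states\<close>

lemma density_spectral_iff:
  "Q \<in> density_matrices \<longleftrightarrow>
    (\<exists>U l. unitary U \<and> (\<forall>i. 0 \<le> l i) \<and> (\<Sum>i\<in>UNIV. l i) = 1 \<and> Q = spectral U l)"
proof
  assume "Q \<in> density_matrices"
  hence Q: "hermitian_psd Q" "trace Q = 1" by (auto simp: density_matrices_def)
  obtain U l where U: "unitary U" "\<And>i. 0 \<le> l i" "Q = spectral U l" using psd_spectral[OF Q(1)] by blast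
  hence "complex_of_real (\<Sum>i\<in>UNIV. l i) = 1" using Q(2) by (metis trace_spectral)
  hence "(\<Sum>i\<in>UNIV. l i) = 1" by (metis of_real_eq_1_iff)
  with U show "\<exists>U l. unitary U \<and> (\<forall>i. 0 \<le> l i) \<and> (\<Sum>i\<in>UNIV. l i) = 1 \<and> Q = spectral U l" by blast
qed (auto simp: density_matrices_def hermitian_psd_spectral trace_spectral)

lemma density_psd: "Q \<in> density_matrices \<Longrightarrow> hermitian_psd Q"
  by (simp add: density_matrices_def)

text \<open>The scalar is the inverse of the Schatten \<open>p\<close>-norm of \<open>S\<close>.
  Dividing by the norm and then taking the \<open>p\<close>-th power of the eigenvalues makes them
  sum to 1, so every nonzero positive direction comes from a state.\<close>

lemma density_normalize:
  fixes S :: "complex^'d^'d"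
  assumes S: "hermitian_psd S" and c: "0 < trace_powr S p" and p: "0 < p"
  obtains Q where "Q \<in> density_matrices"
    "mat_powr Q (1 / p) = trace_powr S p powr (- 1 / p) *\<^sub>R S"
proof -
  obtain U s where U: "unitary U" "\<And>i. 0 \<le> s i" "S = spectral U s" using psd_spectral[OF S] by blast
  define c where "c = trace_powr S p"
  have c: "c > 0" "c = (\<Sum>i\<in>UNIV. s i powr p)" using c U by (simp_all add: c_def trace_powr_spectral)
  have "(s i powr p / c) powr (1 / p) = c powr (- 1 / p) * s i" for i
    using c(1) U(2)[of i] p by (simp add: powr_divide powr_powr powr_minus_divide)
  hence "mat_powr (spectral U (\<lambda>i. s i powr p / c)) (1 / p) = c powr (- 1 / p) *\<^sub>R S"
    using U by (simp add: mat_powr_spectral spectral_scaleR)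
  moreover have "spectral U (\<lambda>i. s i powr p / c) \<in> density_matrices"
    unfolding density_spectral_iff using U c
    by (intro exI[of _ U] exI[of _ "\<lambda>i. s i powr p / c"]) (auto simp flip: sum_divide_distrib)
  ultimately show ?thesis using that by (simp add: c_def)
qed

lemma unitary_mat_1: "unitary (mat 1)"
proof -
  have "conj_transpose (mat 1 :: complex^'d^'d) = mat 1"
    by (simp add: conj_transpose_def mat_def vec_eq_iff)
  thus ?thesis by (simp add: unitary_def)
qed

section \<open>Compactness and kernels\<close>

lemma compact_unitary: "compact {U :: complex^'d^'d. unitary U}"
proof -
  have "norm U \<le> (\<Sum>i\<in>(UNIV::'d set). \<Sum>j\<in>(UNIV::'d set). 1)" if U: "unitary U" for U :: "complex^'d^'d"
  proof -
    have "cmod (U $ i $ j) \<le> 1" for i j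
    proof -
      have "(cmod (U $ i $ j))\<^sup>2 \<le> (\<Sum>j\<in>UNIV. (cmod (U $ i $ j))\<^sup>2)"
        by (intro member_le_sum) auto
      also have "\<dots> = 1" by (rule unitary_row_norm[OF U])
      finally show ?thesis by (simp add: power_le_one_iff abs_square_le_1)
    qed
    hence "norm (U $ i) \<le> (\<Sum>j\<in>(UNIV::'d set). 1)" for i
      unfolding norm_vec_def by (intro order.trans[OF L2_set_le_sum] sum_mono) auto
    thus ?thesis
      unfolding norm_vec_def[of U] by (intro order.trans[OF L2_set_le_sum] sum_mono) auto
  qed
  hence "bounded {U :: complex^'d^'d. unitary U}" by (auto simp: bounded_iff)
  moreover have "closed {U :: complex^'d^'d. unitary U}"
    unfolding unitary_def conj_transpose_def matrix_matrix_mult_def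
    by (intro closed_Collect_conj closed_Collect_eq continuous_on_vec_lambda continuous_intros)
  ultimately show ?thesis by (simp add: compact_eq_bounded_closed)
qed

lemma compact_prob_simplex: "compact (prob_simplex :: (real^'n) set)"
proof -
  have "norm l \<le> 1" if "l \<in> prob_simplex" for l :: "real^'n"
    using norm_le_l1_cart[of l] that by (simp add: prob_simplex_def)
  hence "bounded (prob_simplex :: (real^'n) set)" by (auto simp: bounded_iff)
  moreover have "closed (prob_simplex :: (real^'n) set)"
    unfolding prob_simplex_def
    by (intro closed_Collect_conj closed_Collect_all closed_Collect_eq closed_Collect_le continuous_intros)
  ultimately show ?thesis by (simp add: compact_eq_bounded_closed)
qed

text \<open>In an eigenbasis, a vanishing quadratic form of the power eliminates every component
  with a nonzero eigenvalue. Taking a power thus does not enlarge the kernel, and the full-rank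
  assumption on the \<open>A j\<close> can be carried over to the matrices
  \<open>B j\<close>.\<close>

lemma mat_powr_kernel:
  assumes A: "hermitian_psd A" and x: "x \<bullet> (mat_powr A a *v x) = 0"
  shows "A *v x = 0"
proof -
  obtain U l where U: "unitary U" "\<And>i. 0 \<le> l i" "A = spectral U l" using psd_spectral[OF A] by blast
  have "(\<Sum>i\<in>UNIV. l i powr a * (cmod ((conj_transpose U *v x) $ i))\<^sup>2) = 0"
    using x U by (simp add: mat_powr_spectral spectral_quadratic)
  hence "l i powr a * (cmod ((conj_transpose U *v x) $ i))\<^sup>2 = 0" for i
    by (subst (asm) sum_nonneg_eq_0_iff) auto
  hence "real_diag l *v (conj_transpose U *v x) = 0" by (auto simp: vec_eq_iff real_diag_mult_vec)
  hence "U *v (real_diag l *v (conj_transpose U *v x)) = 0" by simp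
  thus ?thesis by (simp add: U(3) spectral_def matrix_vector_mul_assoc matrix_mul_assoc)
qed

lemma full_rank_kernel:
  fixes A :: "complex^'d^'d"
  assumes "rank A = CARD('d)" "A *v x = 0" shows "x = 0"
proof -
  have "vec.span (rows A) = UNIV"
    using assms(1) vec.dim_eq_full[of "rows A"]
    by (simp add: row_rank_def_gen vec.dimension_def card_cart_basis)
  thus ?thesis
    using assms(2) matrix_left_invertible_span_rows_gen[of A] matrix_left_invertible_ker[of A] by metis
qed

section \<open>Overlaps and the existence of an optimal state\<close>

locale petz =
  fixes \<alpha> :: real and A :: "'n::finite \<Rightarrow> complex^'d^'d"
  assumes alpha: "0 < \<alpha>" "\<alpha> < 1"
    and density: "\<And>j. A j \<in> density_matrices"
    and full_rank: "rank (\<Sum>j\<in>UNIV. A j) = CARD('d)"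
begin

definition p where "p = 1 / (1 - \<alpha>)"

text \<open>\<open>r\<close> equals \<open>1 / (p - 1)\<close>, and \<open>1 + r\<close>, which is
  \<open>1 / \<alpha>\<close>, is the exponent conjugate to \<open>p\<close>.\<close>

definition r where "r = (1 - \<alpha>) / \<alpha>"

definition B where "B = (\<lambda>j. mat_powr (A j) \<alpha>)"

definition overlap where "overlap j Q = tr_prod (B j) (mat_powr Q (1 - \<alpha>))"

lemma pr: "0 < r" "p = 1 + 1 / r" "1 < p" "1 - \<alpha> = 1 / p" "1 / (1 + r) = 1 - 1 / p" "r * p = 1 + r"
proof -
  show r: "0 < r" and p: "p = 1 + 1 / r" and "1 - \<alpha> = 1 / p"
    using alpha by (auto simp: r_def p_def field_simps)
  show "1 < p" using r p by simp
  show "1 / (1 + r) = 1 - 1 / p" "r * p = 1 + r" using r by (auto simp: p field_simps add_pos_pos)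
qed

lemma p_pos: "0 < p"
  using alpha by (simp add: p_def)

lemma B_psd: "hermitian_psd (B j)"
  unfolding B_def using density by (intro hermitian_psd_mat_powr density_psd)

lemma trace_B_pos: "0 < Re (trace (B j))"
proof -
  obtain U l where U: "unitary U" "\<forall>i. 0 \<le> l i" "(\<Sum>i\<in>UNIV. l i) = 1" "A j = spectral U l"
    using density[of j] unfolding density_spectral_iff by blast
  have "\<exists>i. l i \<noteq> 0" using U(3) by (metis sum.neutral zero_neq_one)
  then obtain i where "l i \<noteq> 0" ..
  hence "0 < l i powr \<alpha>" by simp
  also have "\<dots> \<le> (\<Sum>i\<in>UNIV. l i powr \<alpha>)" by (intro member_le_sum) auto
  finally show ?thesis using U by (simp add: B_def mat_powr_spectral trace_spectral)
qed

lemma overlap_nonneg: "Q \<in> density_matrices \<Longrightarrow> 0 \<le> overlap j Q"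
  unfolding overlap_def by (intro tr_prod_nonneg B_psd hermitian_psd_mat_powr density_psd)

text \<open>The maximally mixed state, at which all overlaps are positive and all divergences
  finite.\<close>

definition mixed :: "complex^'d^'d" where "mixed = spectral (mat 1) (\<lambda>_. 1 / real CARD('d))"

lemma mixed_density: "mixed \<in> density_matrices"
  unfolding density_spectral_iff mixed_def using unitary_mat_1
  by (intro exI[of _ "mat 1"] exI[of _ "\<lambda>_. 1 / real CARD('d)"]) auto

lemma overlap_mixed: "0 < overlap j mixed"
proof -
  have "conj_transpose (mat 1 :: complex^'d^'d) = mat 1"
    by (simp add: conj_transpose_def mat_def vec_eq_iff)
  hence "overlap j mixed = (1 / real CARD('d)) powr (1 - \<alpha>) * Re (trace (B j))"
    unfolding overlap_def mixed_def mat_powr_spectral[OF unitary_mat_1] tr_prod_spectral_right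
    by (simp add: trace_def sum_distrib_left)
  thus ?thesis using trace_B_pos by simp
qed

text \<open>Maximising the product of the powers \<open>overlap j Q powr w j\<close> instead of the
  sum of logarithms gives a function continuous on all states, also where an overlap vanishes. Its
  value at \<open>mixed\<close> is positive, hence so is its maximum, and logarithms may be taken
  afterwards.\<close>

lemma overlap_maximizer:
  assumes w: "\<And>j. 0 \<le> w j"
  obtains Q where "Q \<in> density_matrices" "\<And>j. 0 < w j \<Longrightarrow> 0 < overlap j Q"
    "\<And>Q'. Q' \<in> density_matrices \<Longrightarrow> (\<And>j. 0 < w j \<Longrightarrow> 0 < overlap j Q') \<Longrightarrow>
       (\<Sum>j\<in>UNIV. w j * ln (overlap j Q')) \<le> (\<Sum>j\<in>UNIV. w j * ln (overlap j Q))"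
proof -
  \<comment> \<open>Indices of weight 0 are left out: at a vanishing overlap they would contribute
    the factor \<open>0 powr 0 = 0\<close>.\<close>
  define J where "J = {j. 0 < w j}"
  define \<Phi> where "\<Phi> = (\<lambda>Q. \<Prod>j\<in>J. overlap j Q powr w j)"
  \<comment> \<open>States are parametrised by eigenbasis and spectrum. On this compact set the
    matrix power is an explicit expression, so continuity of the overlaps is that of finite
    sums.\<close>
  define K where "K = {U :: complex^'d^'d. unitary U} \<times> (prob_simplex :: (real^'d) set)"
  define \<phi> where "\<phi> = (\<lambda>(U, l :: real^'d). \<Phi> (spectral U (\<lambda>i. l $ i)))"
  have D: "Q \<in> density_matrices \<longleftrightarrow> (\<exists>U l. (U, l) \<in> K \<and> Q = spectral U (\<lambda>i. l $ i))" for Q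
  proof
    assume "Q \<in> density_matrices"
    then obtain U l where U: "unitary U" "\<forall>i. 0 \<le> l i" "(\<Sum>i\<in>UNIV. l i) = 1" "Q = spectral U l"
      unfolding density_spectral_iff by blast
    thus "\<exists>U l. (U, l) \<in> K \<and> Q = spectral U (\<lambda>i. l $ i)"
      by (intro exI[of _ U] exI[of _ "\<chi> i. l i"]) (auto simp: K_def prob_simplex_def)
  qed (auto simp: K_def prob_simplex_def density_spectral_iff)
  have ov: "overlap j (spectral U (\<lambda>i. l $ i)) =
      (\<Sum>i\<in>UNIV. (l $ i) powr (1 - \<alpha>) * Re ((conj_transpose U ** B j ** U) $ i $ i))" if "(U, l) \<in> K" for j U l
    using that by (simp add: K_def overlap_def mat_powr_spectral tr_prod_spectral_right)
  have cont_ov: "continuous_on K (\<lambda>(U, l). overlap j (spectral U (\<lambda>i. l $ i)))" for j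
  proof -
    have "continuous_on K (\<lambda>x. \<Sum>i\<in>UNIV. (snd x $ i) powr (1 - \<alpha>) *
        Re ((conj_transpose (fst x) ** B j ** fst x) $ i $ i))"
      unfolding matrix_matrix_mult_def conj_transpose_def
      by (intro continuous_intros continuous_on_powr' ballI)
        (use alpha in \<open>auto simp: K_def prob_simplex_def intro!: continuous_intros\<close>)
    thus ?thesis by (rule continuous_on_eq) (auto simp: ov)
  qed
  have "continuous_on K \<phi>"
  proof -
    have "continuous_on K (\<lambda>x. \<Prod>j\<in>J. (\<lambda>(U, l). overlap j (spectral U (\<lambda>i. l $ i))) x powr w j)"
      using D overlap_nonneg
      by (intro continuous_on_prod continuous_on_powr' cont_ov continuous_on_const) (force simp: J_def)
    thus ?thesis by (simp add: \<phi>_def \<Phi>_def case_prod_unfold)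
  qed
  moreover have "compact K" unfolding K_def by (intro compact_Times compact_unitary compact_prob_simplex)
  moreover have "K \<noteq> {}" using mixed_density D by blast
  ultimately obtain x where x: "x \<in> K" "\<And>y. y \<in> K \<Longrightarrow> \<phi> y \<le> \<phi> x"
    using continuous_attains_sup by metis
  define Q where "Q = spectral (fst x) (\<lambda>i. snd x $ i)"
  have Q: "Q \<in> density_matrices" unfolding D Q_def using x(1) by (metis prod.collapse)
  have max: "\<Phi> Q' \<le> \<Phi> Q" if "Q' \<in> density_matrices" for Q'
    using that x(2) unfolding D \<phi>_def Q_def by (auto simp: case_prod_unfold)
  have "0 < \<Phi> mixed" unfolding \<Phi>_def using overlap_mixed by (intro prod_pos) (simp add: less_imp_neq[symmetric])
  hence "\<Phi> Q \<noteq> 0" using max[OF mixed_density] by simp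
  hence "overlap j Q \<noteq> 0" if "0 < w j" for j using that by (auto simp: \<Phi>_def J_def)
  hence pos: "0 < overlap j Q" if "0 < w j" for j using overlap_nonneg[OF Q, of j] that by force
  have ln_\<Phi>: "ln (\<Phi> Q') = (\<Sum>j\<in>UNIV. w j * ln (overlap j Q'))" "0 < \<Phi> Q'"
    if "\<And>j. 0 < w j \<Longrightarrow> 0 < overlap j Q'" for Q'
  proof -
    have "ln (\<Phi> Q') = (\<Sum>j\<in>J. w j * ln (overlap j Q'))"
      unfolding \<Phi>_def using that by (subst ln_prod) (fastforce simp: J_def ln_powr)+
    also have "\<dots> = (\<Sum>j\<in>UNIV. w j * ln (overlap j Q'))"
      using w by (intro sum.mono_neutral_left) (auto simp: J_def less_le)
    finally show "ln (\<Phi> Q') = (\<Sum>j\<in>UNIV. w j * ln (overlap j Q'))" .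
    show "0 < \<Phi> Q'" unfolding \<Phi>_def using that by (intro prod_pos) (fastforce simp: J_def)
  qed
  have "(\<Sum>j\<in>UNIV. w j * ln (overlap j Q')) \<le> (\<Sum>j\<in>UNIV. w j * ln (overlap j Q))"
    if "Q' \<in> density_matrices" "\<And>j. 0 < w j \<Longrightarrow> 0 < overlap j Q'" for Q'
    using ln_\<Phi>[of Q'] ln_\<Phi>[of Q] that pos max[of Q'] by (metis ln_mono)
  with Q pos that show ?thesis by blast
qed

section \<open>The value function in terms of overlaps\<close>

lemma petz_div_overlap:
  "petz_div \<alpha> (A j) Q = (if 0 < overlap j Q then ereal (- p * ln (overlap j Q)) else \<infinity>)"
proof -
  have "1 / (\<alpha> - 1) = - p" using alpha by (simp add: p_def field_simps)
  thus ?thesis by (simp add: petz_div_def overlap_def B_def tr_prod_def Let_def)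
qed

text \<open>A weight 0 cancels even an infinite divergence, so positivity of the overlap matters
  exactly at the indices of positive weight.\<close>

lemma weighted_div_overlap:
  assumes w: "\<And>j. 0 \<le> w $ j"
  shows "weighted_div \<alpha> A w Q = (if \<forall>j. 0 < w $ j \<longrightarrow> 0 < overlap j Q
    then ereal (- (p * (\<Sum>j\<in>UNIV. w $ j * ln (overlap j Q)))) else \<infinity>)"
proof (cases "\<forall>j. 0 < w $ j \<longrightarrow> 0 < overlap j Q")
  case True
  have "ereal (w $ j) * petz_div \<alpha> (A j) Q = ereal (- p * (w $ j * ln (overlap j Q)))" for j
    using True w[of j] by (cases "w $ j = 0") (auto simp: petz_div_overlap less_le zero_ereal_def[symmetric])
  thus ?thesis using True by (simp add: weighted_div_def sum_distrib_left sum_negf)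
next
  case False
  then obtain j where "0 < w $ j" "\<not> 0 < overlap j Q" by blast
  hence "ereal (w $ j) * petz_div \<alpha> (A j) Q = \<infinity>" by (simp add: petz_div_overlap)
  hence "weighted_div \<alpha> A w Q = \<infinity>"
    unfolding weighted_div_def by (subst sum_Pinfty) (auto intro!: bexI[of _ j])
  thus ?thesis using False by simp
qed

lemma petz_g_eq:
  assumes w: "\<And>j. 0 \<le> w $ j" and Q: "Q \<in> density_matrices" "\<And>j. 0 < w $ j \<Longrightarrow> 0 < overlap j Q"
    and max: "\<And>Q'. Q' \<in> density_matrices \<Longrightarrow> (\<And>j. 0 < w $ j \<Longrightarrow> 0 < overlap j Q') \<Longrightarrow>
       (\<Sum>j\<in>UNIV. w $ j * ln (overlap j Q')) \<le> (\<Sum>j\<in>UNIV. w $ j * ln (overlap j Q))"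
  shows "petz_g \<alpha> A w = p * (\<Sum>j\<in>UNIV. w $ j * ln (overlap j Q))"
proof -
  have "weighted_div \<alpha> A w Q \<le> weighted_div \<alpha> A w Q'" if "Q' \<in> density_matrices" for Q'
    unfolding weighted_div_overlap[OF w] using Q(2) max[OF that] p_pos by auto
  hence min: "is_arg_min (weighted_div \<alpha> A w) (\<lambda>Q. Q \<in> density_matrices) Q"
    using Q(1) by (auto simp: is_arg_min_def not_less)
  \<comment> \<open>Since a minimiser exists, the chosen \<open>Q_star\<close> is one too; any two
    minimisers have the same value.\<close>
  hence "is_arg_min (weighted_div \<alpha> A w) (\<lambda>Q. Q \<in> density_matrices) (Q_star \<alpha> A w)"
    unfolding Q_star_def arg_min_on_def arg_min_def by (rule someI)
  with min have "weighted_div \<alpha> A w (Q_star \<alpha> A w) = weighted_div \<alpha> A w Q"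
    unfolding is_arg_min_def by (meson linorder_neqE)
  thus ?thesis unfolding petz_g_def weighted_div_overlap[OF w] using Q(2) by simp
qed

lemma petz_g_ge:
  assumes w: "\<And>j. 0 \<le> w $ j" and Q: "Q \<in> density_matrices" "\<And>j. 0 < w $ j \<Longrightarrow> 0 < overlap j Q"
  shows "p * (\<Sum>j\<in>UNIV. w $ j * ln (overlap j Q)) \<le> petz_g \<alpha> A w"
proof -
  obtain Q0 where Q0: "Q0 \<in> density_matrices" "\<And>j. 0 < w $ j \<Longrightarrow> 0 < overlap j Q0"
    "\<And>Q'. Q' \<in> density_matrices \<Longrightarrow> (\<And>j. 0 < w $ j \<Longrightarrow> 0 < overlap j Q') \<Longrightarrow>
       (\<Sum>j\<in>UNIV. w $ j * ln (overlap j Q')) \<le> (\<Sum>j\<in>UNIV. w $ j * ln (overlap j Q0))"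
    using overlap_maximizer[of "\<lambda>j. w $ j"] w by blast
  have "petz_g \<alpha> A w = p * (\<Sum>j\<in>UNIV. w $ j * ln (overlap j Q0))"
    by (rule petz_g_eq) (use w Q0 in auto)
  thus ?thesis using Q0(3)[OF Q] p_pos by simp
qed

section \<open>First-order optimality and the contraction inequality\<close>

lemma trace_powr_density:
  fixes Q :: "complex^'d^'d"
  assumes "Q \<in> density_matrices" shows "trace_powr (mat_powr Q (1 - \<alpha>)) p = 1"
  unfolding pr(4) using p_pos assms
  by (simp add: trace_powr_mat_powr density_psd) (simp add: trace_powr_def mat_powr_1 density_matrices_def)

text \<open>The segment from \<open>S0\<close> to \<open>S\<close> stays in the Schatten
  \<open>p\<close>-ball by \<open>trace_powr_convex\<close>. If the bound failed, the weighted sum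
  of logarithms would grow initially along it; normalising the resulting point to a state can only
  increase its overlaps, contrary to the maximality of \<open>Q\<close>.\<close>

lemma first_order_optimality:
  fixes w :: "'n \<Rightarrow> real"
  assumes w: "\<And>j. 0 < w j" and Q: "Q \<in> density_matrices" "\<And>j. 0 < overlap j Q"
    and max: "\<And>Q'. Q' \<in> density_matrices \<Longrightarrow> (\<And>j. 0 < overlap j Q') \<Longrightarrow>
       (\<Sum>j\<in>UNIV. w j * ln (overlap j Q')) \<le> (\<Sum>j\<in>UNIV. w j * ln (overlap j Q))"
    and S: "hermitian_psd S" "trace_powr S p \<le> 1"
  shows "(\<Sum>j\<in>UNIV. w j / overlap j Q * tr_prod (B j) S) \<le> (\<Sum>j\<in>UNIV. w j)"
proof (rule ccontr)
  \<comment> \<open>Because \<open>(1 - \<alpha>) * p = 1\<close>, this substitution takes states to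
    positive matrices of Schatten \<open>p\<close>-norm 1, on which the overlaps are linear.\<close>
  define S0 where "S0 = mat_powr Q (1 - \<alpha>)"
  have S0: "hermitian_psd S0" "trace_powr S0 p = 1"
    unfolding S0_def using Q(1) by (auto intro: hermitian_psd_mat_powr density_psd trace_powr_density)
  define W where "W = (\<lambda>j. overlap j Q)"
  have W: "W j = tr_prod (B j) S0" "0 < W j" for j using Q by (auto simp: W_def overlap_def S0_def)
  define x where "x = (\<lambda>j. tr_prod (B j) S / W j)"
  have x: "0 \<le> x j" "tr_prod (B j) S = W j * x j" for j
    using W(2)[of j] tr_prod_nonneg[OF B_psd S(1), of j] by (auto simp: x_def)
  \<comment> \<open>The change of the objective along the segment before normalisation, since
    \<open>tr_prod (B j) St = W j * (1 + t * (x j - 1))\<close>.\<close>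
  define \<phi> where "\<phi> = (\<lambda>t. \<Sum>j\<in>UNIV. w j * ln (1 + t * (x j - 1)))"
  assume "\<not> ?thesis"
  hence pos: "0 < (\<Sum>j\<in>UNIV. w j * (x j - 1))"
    by (simp add: x_def W_def algebra_simps sum_subtractf)
  have "(\<phi> has_real_derivative (\<Sum>j\<in>UNIV. w j * (x j - 1))) (at 0)"
    unfolding \<phi>_def by (auto intro!: derivative_eq_intros simp: mult.commute)
  then obtain d where d: "d > 0" "\<And>h. 0 < h \<Longrightarrow> h < d \<Longrightarrow> \<phi> 0 < \<phi> (0 + h)"
    using DERIV_pos_inc_right[OF _ pos] by blast
  define t where "t = min (1 / 2) (d / 2)"
  have t: "0 < t" "t < 1" "t < d" using d(1) by (auto simp: t_def min_def)
  have "\<phi> 0 = 0" by (simp add: \<phi>_def)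
  hence \<phi>t: "0 < \<phi> t" using d(2)[OF t(1,3)] by simp
  define St where "St = (1 - t) *\<^sub>R S0 + t *\<^sub>R S"
  define c where "c = trace_powr St p"
  have St: "hermitian_psd St" unfolding St_def
    using S(1) S0(1) t by (intro hermitian_psd_add hermitian_psd_scaleR) auto
  have tp: "tr_prod (B j) St = W j * (1 + t * (x j - 1))" for j
    unfolding St_def tr_prod_add_right tr_prod_scaleR_right x(2) W(1)[symmetric]
    by (simp add: algebra_simps)
  have fac: "0 < 1 + t * (x j - 1)" for j
  proof -
    have "0 < (1 - t) + t * x j" using t x(1)[of j] by (intro add_pos_nonneg) auto
    thus ?thesis by (simp add: algebra_simps)
  qed
  hence tp_pos: "0 < tr_prod (B j) St" for j using W(2) by (simp add: tp)
  have c1: "c \<le> 1"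
  proof -
    have "c \<le> (1 - t) * trace_powr S0 p + t * trace_powr S p"
      unfolding c_def St_def using trace_powr_convex[OF S0(1) S(1) _ _ pr(1), of t] t by (simp flip: pr(2))
    also have "\<dots> \<le> (1 - t) * 1 + t * 1" using t S(2) S0(2) by (intro add_mono mult_left_mono) auto
    finally show ?thesis by simp
  qed
  \<comment> \<open>Otherwise all eigenvalues of \<open>St\<close> vanish, and with them the
    overlaps, which are positive by \<open>tp_pos\<close>.\<close>
  have c0: "0 < c"
  proof (rule ccontr)
    obtain U s where U: "unitary U" "\<And>i. 0 \<le> s i" "St = spectral U s" using psd_spectral[OF St] by blast
    assume "\<not> 0 < c"
    hence "(\<Sum>i\<in>UNIV. s i powr p) = 0" using trace_powr_nonneg[OF St, of p] U
      by (simp add: c_def trace_powr_spectral)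
    hence "s i powr p = 0" for i by (subst (asm) sum_nonneg_eq_0_iff) auto
    hence "tr_prod (B j) St = 0" for j by (simp add: U(3) tr_prod_spectral_right)
    thus False using tp_pos by simp
  qed
  obtain Q' where Q': "Q' \<in> density_matrices" "mat_powr Q' (1 - \<alpha>) = c powr (- 1 / p) *\<^sub>R St"
    using density_normalize[OF St c0[unfolded c_def] p_pos] unfolding c_def pr(4) by blast
  have ge: "tr_prod (B j) St \<le> overlap j Q'" for j
  proof -
    have "1 \<le> c powr (- 1 / p)"
      using c0 c1 p_pos powr_mono_both'[of "- 1 / p" 0 c c] powr_mono'[of "- 1 / p" 0 c] by simp
    hence "1 * tr_prod (B j) St \<le> c powr (- 1 / p) * tr_prod (B j) St"
      using tp_pos[of j] by (intro mult_right_mono) auto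
    thus ?thesis by (simp add: overlap_def Q'(2) tr_prod_scaleR_right)
  qed
  have "(\<Sum>j\<in>UNIV. w j * ln (tr_prod (B j) St)) \<le> (\<Sum>j\<in>UNIV. w j * ln (overlap j Q'))"
    using w ge tp_pos by (intro sum_mono mult_left_mono ln_mono) (auto intro: less_imp_le less_le_trans)
  also have "\<dots> \<le> (\<Sum>j\<in>UNIV. w j * ln (W j))"
    unfolding W_def using ge tp_pos by (intro max Q') (auto intro: less_le_trans)
  finally have "(\<Sum>j\<in>UNIV. w j * ln (tr_prod (B j) St)) \<le> (\<Sum>j\<in>UNIV. w j * ln (W j))" .
  moreover have "w j * ln (tr_prod (B j) St) = w j * ln (W j) + w j * ln (1 + t * (x j - 1))" for j
    unfolding tp ln_mult_pos[OF W(2) fac] by (rule distrib_left)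
  ultimately have "\<phi> t \<le> 0" by (simp add: \<phi>_def sum.distrib)
  thus False using \<phi>t by simp
qed

text \<open>An eigenvector for the eigenvalue 0 annihilates the quadratic form of every
  \<open>B j\<close>, hence lies in the kernel of every \<open>A j\<close>, which the full rank of
  their sum excludes. Positivity permits the negative powers used in the interpolation.\<close>

lemma weighted_B_eigenvalue_pos:
  assumes c: "\<And>j. 0 < c j" and N: "(\<Sum>j\<in>UNIV. c j *\<^sub>R B j) = spectral V n" and V: "unitary V"
  shows "0 < n k"
proof -
  let ?x = "V *v axis k 1"
  have q: "?x \<bullet> (spectral V n *v ?x) = n k"
    by (simp add: spectral_quadratic unitary_cancel_left[OF V] axis_def if_distrib if_distribR cong: if_cong)
  have sv: "(\<Sum>j\<in>UNIV. f j) *v v = (\<Sum>j\<in>UNIV. f j *v v)" for f :: "'n \<Rightarrow> complex^'d^'d" and v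
    by (simp add: vec_eq_iff matrix_vector_mult_def sum_distrib_right) (intro allI sum.swap)
  have e: "n k = (\<Sum>j\<in>UNIV. c j * (?x \<bullet> (B j *v ?x)))"
    by (simp add: q[symmetric] N[symmetric] sv inner_sum_right scaleR_matrix_vector)
  have nn: "0 \<le> c j * (?x \<bullet> (B j *v ?x))" for j
    using B_psd[of j] c[of j] by (simp add: hermitian_psd_inner less_imp_le)
  have "n k \<noteq> 0"
  proof
    assume "n k = 0"
    hence "c j * (?x \<bullet> (B j *v ?x)) = 0" for j
      using e nn by (simp add: sum_nonneg_eq_0_iff)
    hence "?x \<bullet> (B j *v ?x) = 0" for j using c[of j] by (metis mult_eq_0_iff less_irrefl)
    hence "A j *v ?x = 0" for j
      unfolding B_def by (rule mat_powr_kernel[OF density_psd[OF density]])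
    hence "(\<Sum>j\<in>UNIV. A j) *v ?x = 0" by (simp add: sv)
    hence "?x = 0" by (rule full_rank_kernel[OF full_rank])
    hence "axis k (1 :: complex) = 0" using unitary_cancel_left[OF V, of "axis k 1"] by simp
    thus False by (simp add: axis_eq_0_iff)
  qed
  moreover have "0 \<le> n k" unfolding e by (intro sum_nonneg nn)
  ultimately show ?thesis by simp
qed

text \<open>At the optimal \<open>Q\<close> the power \<open>Q\<^sup>1\<^sup>-\<^sup>\<alpha>\<close> attains equality in Young's inequality against
  \<open>N\<close>, so it equals \<open>N\<^sup>r\<close>; interpolation with \<open>x j = overlap j Q' / overlap j Q\<close> then
  bounds the left-hand side by its own power with an exponent below \<open>1\<close>.\<close>

lemma optimal_overlaps:
  fixes w :: "'n \<Rightarrow> real"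
  assumes w: "\<And>j. 0 < w j" and Q: "Q \<in> density_matrices" "\<And>j. 0 < overlap j Q"
    and max: "\<And>Q'. Q' \<in> density_matrices \<Longrightarrow> (\<And>j. 0 < overlap j Q') \<Longrightarrow>
       (\<Sum>j\<in>UNIV. w j * ln (overlap j Q')) \<le> (\<Sum>j\<in>UNIV. w j * ln (overlap j Q))"
    and Q': "Q' \<in> density_matrices"
  shows "(\<Sum>j\<in>UNIV. w j * (overlap j Q' / overlap j Q) powr p) \<le> (\<Sum>j\<in>UNIV. w j)"
proof -
  define \<sigma> where "\<sigma> = (\<Sum>j\<in>UNIV. w j)"
  have \<sigma>: "0 < \<sigma>" unfolding \<sigma>_def using w by (intro sum_pos) auto
  define S0 where "S0 = mat_powr Q (1 - \<alpha>)"
  have S0: "hermitian_psd S0" "trace_powr S0 p = 1"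
    unfolding S0_def using Q(1) by (auto intro: hermitian_psd_mat_powr density_psd trace_powr_density)
  define W where "W = (\<lambda>j. overlap j Q)"
  have W: "W j = tr_prod (B j) S0" "0 < W j" for j using Q by (auto simp: W_def overlap_def S0_def)
  \<comment> \<open>With these weights \<open>tr_prod N S0 = 1\<close>, while first-order optimality
    bounds \<open>tr_prod N\<close> by 1 on the positive part of the Schatten \<open>p\<close>-ball.
    The division by \<sigma> accounts for weights that need not sum to 1.\<close>
  define c where "c = (\<lambda>j. w j / (W j * \<sigma>))"
  have c: "0 < c j" for j using w W \<sigma> by (simp add: c_def)
  define N where "N = (\<Sum>j\<in>UNIV. c j *\<^sub>R B j)"
  have N: "hermitian_psd N" unfolding N_def using c
    by (intro hermitian_psd_sum hermitian_psd_scaleR B_psd) (auto intro: less_imp_le)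
  have tN: "tr_prod N S = (\<Sum>j\<in>UNIV. c j * tr_prod (B j) S)" for S
    by (simp add: N_def tr_prod_sum_left tr_prod_scaleR_left)
  have N1: "tr_prod N S \<le> 1" if "hermitian_psd S" "trace_powr S p \<le> 1" for S
  proof -
    have "tr_prod N S = (\<Sum>j\<in>UNIV. w j / W j * tr_prod (B j) S) / \<sigma>"
      unfolding tN c_def sum_divide_distrib by (intro sum.cong) (auto simp: field_simps)
    also have "\<dots> \<le> \<sigma> / \<sigma>"
      using first_order_optimality[OF w Q max that] \<sigma>
      by (intro divide_right_mono) (auto simp: W_def \<sigma>_def)
    finally show ?thesis using \<sigma> by simp
  qed
  have "tr_prod N S0 = (\<Sum>j\<in>UNIV. w j / \<sigma>)"
    unfolding tN c_def W(1)[symmetric] using W(2) by (intro sum.cong) (auto simp: less_imp_neq[symmetric])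
  hence NS0: "tr_prod N S0 = 1" using \<sigma> by (simp add: \<sigma>_def flip: sum_divide_distrib)
  obtain V n where V: "unitary V" "\<And>i. 0 \<le> n i" "N = spectral V n" using psd_spectral[OF N] by blast
  have "(\<Sum>j\<in>UNIV. c j *\<^sub>R B j) = spectral V n" using V(3) by (simp add: N_def)
  hence n: "0 < n k" for k by (rule weighted_B_eigenvalue_pos[OF c _ V(1)])
  define \<tau> where "\<tau> = trace_powr N (1 + r)"
  have "0 < \<tau>" unfolding \<tau>_def V(3) trace_powr_spectral[OF V(1)] using n by (intro sum_pos) (auto simp: less_imp_neq[symmetric])
  have "\<tau> \<le> 1"
  proof -
    \<comment> \<open>The extremal direction for \<open>N\<close>, scaled to Schatten
      \<open>p\<close>-norm 1; pairing it with \<open>N\<close> turns \<open>N1\<close> into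
      \<open>\<tau> powr (1 - 1 / p) \<le> 1\<close>.\<close>
    let ?S = "\<tau> powr (- 1 / p) *\<^sub>R mat_powr N r"
    have "(\<tau> powr (- 1 / p)) powr p * \<tau> = 1"
      unfolding powr_powr using \<open>0 < \<tau>\<close> p_pos by (simp add: powr_minus_divide)
    hence "trace_powr ?S p = 1"
      by (simp add: trace_powr_scaleR hermitian_psd_mat_powr N trace_powr_mat_powr pr(6) del: powr_minus flip: \<tau>_def)
    hence "tr_prod N ?S \<le> 1" by (intro N1 hermitian_psd_scaleR hermitian_psd_mat_powr N) auto
    moreover have "tr_prod N (mat_powr N r) = \<tau>"
      using tr_prod_mat_powr[OF N, of 1 r] by (simp add: mat_powr_1[OF N] \<tau>_def)
    ultimately have "\<tau> powr (- 1 / p) * \<tau> powr 1 \<le> 1" using \<open>0 < \<tau>\<close> by (simp add: tr_prod_scaleR_right)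
    moreover have "\<tau> powr (- 1 / p) * \<tau> powr 1 = \<tau> powr (1 - 1 / p)"
      unfolding powr_add[symmetric] by simp
    ultimately have "\<tau> powr (1 - 1 / p) \<le> 1" by simp
    moreover have "0 < 1 - 1 / p" using pr(3) by simp
    ultimately show ?thesis using gr_one_powr[of \<tau> "1 - 1 / p"] by linarith
  qed
  \<comment> \<open>This closes a squeeze: \<open>tr_prod N S0 = 1\<close> lies below the right-hand
    side of Young's inequality, which is itself at most 1, so equality holds.\<close>
  have "\<tau> / (1 + r) + 1 / p \<le> 1"
  proof -
    have "\<tau> / (1 + r) \<le> 1 / (1 + r)" using \<open>\<tau> \<le> 1\<close> pr(1) by (intro divide_right_mono) auto
    thus ?thesis using pr(5) by linarith
  qed
  moreover have "tr_prod N S0 \<le> \<tau> / (1 + r) + 1 / p"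
    using young_trace(1)[OF N S0(1) pr(1)] S0(2) by (simp add: \<tau>_def flip: pr(2))
  ultimately have "tr_prod N S0 = \<tau> / (1 + r) + 1 / p" using NS0 by simp
  hence S0N: "S0 = mat_powr N r"
    by (intro young_trace(2)[OF N S0(1) pr(1)]) (use S0(2) in \<open>simp add: \<tau>_def flip: pr(2)\<close>)
  define S where "S = mat_powr Q' (1 - \<alpha>)"
  have S: "hermitian_psd S" "trace_powr S p = 1"
    unfolding S_def using Q' by (auto intro: hermitian_psd_mat_powr density_psd trace_powr_density)
  define x where "x = (\<lambda>j. overlap j Q' / W j)"
  have x: "0 \<le> x j" "tr_prod (B j) S = x j * W j" for j
    using W(2)[of j] overlap_nonneg[OF Q', of j] by (auto simp: x_def overlap_def S_def)
  define M where "M = (\<Sum>j\<in>UNIV. w j * x j powr p) / \<sigma>"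
  \<comment> \<open>As \<open>S0\<close> is the \<open>r\<close>-th power of \<open>N\<close>, each
    pairing \<open>tr_prod (c j *\<^sub>R B j) S0\<close> is \<open>w j / \<sigma>\<close>; thus
    \<open>M\<close> has the form required by \<open>interpolation\<close>.\<close>
  have M: "M = (\<Sum>j\<in>UNIV. x j powr p * tr_prod (c j *\<^sub>R B j) (mat_powr (\<Sum>j\<in>UNIV. c j *\<^sub>R B j) r))"
    unfolding N_def[symmetric] S0N[symmetric] tr_prod_scaleR_left W(1)[symmetric] M_def sum_divide_distrib
    using W(2) by (intro sum.cong) (auto simp: c_def less_imp_neq[symmetric])
  have "M \<le> 1"
  proof (rule ccontr)
    assume "\<not> M \<le> 1"
    hence M1: "1 < M" by simp
    have "(\<Sum>j\<in>UNIV. x j powr (p - 1) * tr_prod (c j *\<^sub>R B j) S) \<le> M powr (1 - 1 / p)"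
      by (rule interpolation[OF _ V(1) _ n S(1) pr(1,2) _ x(1) M])
        (use c S(2) M1 V(3) in \<open>auto intro!: hermitian_psd_scaleR B_psd less_imp_le simp: N_def\<close>)
    moreover have "x j powr (p - 1) * tr_prod (c j *\<^sub>R B j) S = w j * x j powr p / \<sigma>" for j
    proof -
      have "x j powr (p - 1) * x j = x j powr p"
        using x(1)[of j] powr_add[of "x j" "p - 1" 1] by (cases "x j = 0") auto
      thus ?thesis unfolding tr_prod_scaleR_left x(2) using W(2)[of j]
        by (simp add: c_def)
    qed
    ultimately have "M powr 1 \<le> M powr (1 - 1 / p)" using M1 by (simp add: M_def sum_divide_distrib)
    moreover have "M powr (1 - 1 / p) < M powr 1" using M1 p_pos by (intro powr_less_mono) auto
    ultimately show False by simp
  qed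
  thus ?thesis using \<sigma> by (simp add: M_def x_def W_def \<sigma>_def[symmetric] field_simps)
qed

end

section \<open>Relative entropy and relative smoothness\<close>

text \<open>The generalised relative entropy. The linear terms make every summand nonnegative on the
  whole orthant, where the gradients are taken; they cancel in the sum for probability
  vectors.\<close>

definition kl :: "real^'n \<Rightarrow> real^'n \<Rightarrow> real" where
  "kl v u = (\<Sum>j\<in>UNIV. v $ j * ln (v $ j / u $ j) - v $ j + u $ j)"

text \<open>For positive \<open>v\<close> this is \<open>ln s \<le> s - 1\<close> at
  \<open>s = u / v\<close>, with equality only at \<open>s = 1\<close>.\<close>

lemma kl_term_nonneg:
  fixes v u :: real
  assumes "0 \<le> v" "0 < u"
  shows "0 \<le> v * ln (v / u) - v + u" "v * ln (v / u) - v + u = 0 \<Longrightarrow> v = u"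
proof -
  have "0 \<le> v * ln (v / u) - v + u \<and> (v * ln (v / u) - v + u = 0 \<longrightarrow> v = u)"
  proof (cases "v = 0")
    case False
    hence v: "0 < v" using assms by simp
    have e: "v * ln (v / u) - v + u = v * ((u / v - 1) - ln (u / v))"
      using v assms(2) by (simp add: ln_div field_simps)
    have "ln (u / v) \<le> u / v - 1" using v assms(2) by (intro ln_le_minus_one) auto
    hence "0 \<le> v * ln (v / u) - v + u" unfolding e using v by simp
    moreover have "v = u" if "v * ln (v / u) - v + u = 0"
    proof -
      have "ln (u / v) = u / v - 1" using that v unfolding e by simp
      hence "u / v = 1" using v assms(2) by (intro ln_eq_minus_one) auto
      thus ?thesis by simp
    qed
    ultimately show ?thesis by blast
  qed (use assms in auto)
  thus "0 \<le> v * ln (v / u) - v + u" "v * ln (v / u) - v + u = 0 \<Longrightarrow> v = u" by blast+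
qed

lemma kl_nonneg: "(\<And>j. 0 \<le> v $ j) \<Longrightarrow> (\<And>j. 0 < u $ j) \<Longrightarrow> 0 \<le> kl v u"
  unfolding kl_def by (intro sum_nonneg kl_term_nonneg) auto

lemma kl_eq_0:
  assumes "\<And>j. 0 \<le> v $ j" "\<And>j. 0 < u $ j" "kl v u = 0" shows "v = u"
proof -
  have "v $ j * ln (v $ j / u $ j) - v $ j + u $ j = 0" for j
    using assms(3) unfolding kl_def
    by (subst (asm) sum_nonneg_eq_0_iff) (auto intro: kl_term_nonneg assms)
  thus ?thesis using kl_term_nonneg(2)[OF assms(1,2)] by (simp add: vec_eq_iff)
qed

section \<open>Gradients from two-sided bounds\<close>

lemma gradient_eqI:
  assumes "GDERIV f x :> D" shows "gradient f x = D"
  unfolding gradient_def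
proof (rule the_equality)
  fix D' assume "GDERIV f x :> D'"
  hence "(\<lambda>h. h \<bullet> D') = (\<lambda>h. h \<bullet> D)" using assms unfolding gderiv_def by (rule has_derivative_unique)
  hence "h \<bullet> D' = h \<bullet> D" for h by meson
  thus "D' = D" by (metis inner_commute vector_eq_rdot)
qed (rule assms)

text \<open>Near \<open>u\<close> the term \<open>kl v u\<close> is of second order in
  \<open>v - u\<close>, so a function caught between an affine function and the same function plus
  \<open>kl\<close> is differentiable with the affine slope as its gradient. This applies to both
  \<open>petz_g\<close> and \<open>neg_entropy\<close>.\<close>

lemma gradient_of_kl_bound:
  fixes f :: "real^'n \<Rightarrow> real"
  assumes u: "\<And>j. 0 < u $ j"
    and lower: "\<And>v. (\<And>j. 0 < v $ j) \<Longrightarrow> f u + D \<bullet> (v - u) \<le> f v"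
    and upper: "\<And>v. (\<And>j. 0 < v $ j) \<Longrightarrow> f v \<le> f u + D \<bullet> (v - u) + kl v u"
  shows "gradient f u = D"
proof (rule gradient_eqI)
  \<comment> \<open>The least entry of \<open>u\<close> serves twice: as the radius of a ball inside
    the positive orthant and as the denominator of the quadratic bound.\<close>
  define m where "m = Min (range (\<lambda>j. u $ j))"
  have m: "0 < m" "m \<le> u $ j" for j unfolding m_def using u by (auto simp: Min_gr_iff)
  have bound: "\<bar>f v - f u - D \<bullet> (v - u)\<bar> \<le> (norm (v - u))\<^sup>2 / m" if "norm (v - u) < m" for v
  proof -
    have v: "0 < v $ j" for j
    proof -
      have "\<bar>(v - u) $ j\<bar> \<le> norm (v - u)" by (rule component_le_norm_cart)
      thus ?thesis using that m(2)[of j] by simp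
    qed
    \<comment> \<open>By \<open>ln s \<le> s - 1\<close> at \<open>s = v $ j / u $ j\<close>, the
      relative entropy is at most the chi-square divergence.\<close>
    have "kl v u \<le> (\<Sum>j\<in>UNIV. ((v - u) $ j)\<^sup>2 / m)"
      unfolding kl_def
    proof (rule sum_mono)
      fix j
      have "v $ j * ln (v $ j / u $ j) \<le> v $ j * (v $ j / u $ j - 1)"
        using u v by (intro mult_left_mono ln_le_minus_one) (auto intro: less_imp_le)
      hence "v $ j * ln (v $ j / u $ j) - v $ j + u $ j \<le> ((v - u) $ j)\<^sup>2 / u $ j"
        using u[of j] by (simp add: field_simps power2_eq_square)
      also have "\<dots> \<le> ((v - u) $ j)\<^sup>2 / m"
        using m(1) m(2)[of j] by (intro divide_left_mono) auto
      finally show "v $ j * ln (v $ j / u $ j) - v $ j + u $ j \<le> ((v - u) $ j)\<^sup>2 / m" .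
    qed
    also have "\<dots> = (norm (v - u))\<^sup>2 / m"
      unfolding power2_norm_eq_inner inner_vec_def by (simp add: power2_eq_square flip: sum_divide_distrib)
    finally show ?thesis using lower[OF v] upper[OF v] by linarith
  qed
  show "GDERIV f u :> D"
    unfolding gderiv_def has_derivative_at_alt
  proof (intro conjI allI impI)
    show "bounded_linear (\<lambda>h. h \<bullet> D)" by (rule bounded_linear_inner_left)
    fix e :: real assume e: "0 < e"
    show "\<exists>d>0. \<forall>v. norm (v - u) < d \<longrightarrow> norm (f v - f u - (v - u) \<bullet> D) \<le> e * norm (v - u)"
    proof (intro exI[of _ "min m (e * m)"] conjI allI impI)
      fix v assume v: "norm (v - u) < min m (e * m)"
      have "(norm (v - u))\<^sup>2 / m = (norm (v - u) / m) * norm (v - u)" by (simp add: power2_eq_square)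
      also have "\<dots> \<le> e * norm (v - u)" using v m(1) by (intro mult_right_mono) (auto simp: field_simps)
      finally show "norm (f v - f u - (v - u) \<bullet> D) \<le> e * norm (v - u)"
        using bound[of v] v by (simp add: inner_commute)
    qed (use m e in auto)
  qed
qed

lemma neg_entropy_kl:
  assumes "\<And>j. 0 \<le> v $ j" "\<And>j. 0 < u $ j"
  shows "neg_entropy v = neg_entropy u + (\<chi> j. ln (u $ j) + 1) \<bullet> (v - u) + kl v u"
proof -
  have "v $ j * ln (v $ j) = u $ j * ln (u $ j) + (ln (u $ j) + 1) * (v $ j - u $ j) +
      (v $ j * ln (v $ j / u $ j) - v $ j + u $ j)" for j
    using assms(1)[of j] assms(2)[of j] by (cases "v $ j = 0") (auto simp: ln_div algebra_simps)
  thus ?thesis by (simp add: neg_entropy_def kl_def inner_vec_def flip: sum.distrib)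
qed

lemma bregman_neg_entropy:
  fixes u v :: "real^'a"
  assumes "\<And>j. 0 \<le> v $ j" "\<And>j. 0 < u $ j"
  shows "bregman neg_entropy v u = kl v u"
proof -
  have "gradient neg_entropy u = (\<chi> j. ln (u $ j) + 1)"
  proof (rule gradient_of_kl_bound[OF assms(2)])
    fix x :: "real^'a" assume "\<And>j. 0 < x $ j"
    hence x: "0 \<le> x $ j" for j by (simp add: less_imp_le)
    note * = neg_entropy_kl[OF x assms(2)]
    show "neg_entropy u + (\<chi> j. ln (u $ j) + 1) \<bullet> (x - u) \<le> neg_entropy x"
      unfolding * using kl_nonneg[OF x assms(2)] by simp
    show "neg_entropy x \<le> neg_entropy u + (\<chi> j. ln (u $ j) + 1) \<bullet> (x - u) + kl x u"
      unfolding * by simp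
  qed
  thus ?thesis using neg_entropy_kl[OF assms] by (simp add: bregman_def)
qed

context petz
begin

text \<open>The equality is Euler's identity for a function homogeneous of degree 1. An optimal
  state for \<open>u\<close> is admissible at every \<open>v\<close> and gives the lower bound. For
  the upper bound, \<open>ln s \<le> s - 1\<close> at \<open>s = x j powr p * u $ j / v $ j\<close>
  reduces the claim to \<open>optimal_overlaps\<close>. The slope \<open>G\<close> of both bounds is
  the gradient by \<open>gradient_of_kl_bound\<close>.\<close>

lemma petz_g_relative_smoothness:
  assumes u: "\<And>j. 0 < u $ j"
  shows "petz_g \<alpha> A u = gradient (petz_g \<alpha> A) u \<bullet> u"
    and "(\<And>j. 0 \<le> v $ j) \<Longrightarrow> gradient (petz_g \<alpha> A) u \<bullet> v \<le> petz_g \<alpha> A v"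
    and "(\<And>j. 0 \<le> v $ j) \<Longrightarrow> petz_g \<alpha> A v \<le> gradient (petz_g \<alpha> A) u \<bullet> v + kl v u"
proof -
  have u0: "0 \<le> u $ j" for j using u[of j] by simp
  obtain Q where Q: "Q \<in> density_matrices" "\<And>j. 0 < overlap j Q"
    "\<And>Q'. Q' \<in> density_matrices \<Longrightarrow> (\<And>j. 0 < overlap j Q') \<Longrightarrow>
       (\<Sum>j\<in>UNIV. u $ j * ln (overlap j Q')) \<le> (\<Sum>j\<in>UNIV. u $ j * ln (overlap j Q))"
  proof -
    obtain Q where Q: "Q \<in> density_matrices" "\<And>j. 0 < u $ j \<Longrightarrow> 0 < overlap j Q"
      "\<And>Q'. Q' \<in> density_matrices \<Longrightarrow> (\<And>j. 0 < u $ j \<Longrightarrow> 0 < overlap j Q') \<Longrightarrow>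
         (\<Sum>j\<in>UNIV. u $ j * ln (overlap j Q')) \<le> (\<Sum>j\<in>UNIV. u $ j * ln (overlap j Q))"
      using overlap_maximizer[of "\<lambda>j. u $ j"] u0 by blast
    show ?thesis by (rule that[OF Q(1) Q(2)[OF u] Q(3)])
  qed
  define G where "G = (\<chi> j. p * ln (overlap j Q))"
  have G: "G \<bullet> v = p * (\<Sum>j\<in>UNIV. v $ j * ln (overlap j Q))" for v
    by (simp add: G_def inner_vec_def sum_distrib_left mult_ac)
  have g: "petz_g \<alpha> A u = G \<bullet> u"
    unfolding G by (rule petz_g_eq) (use u u0 Q in auto)
  have lower: "G \<bullet> v \<le> petz_g \<alpha> A v" if "\<And>j. 0 \<le> v $ j" for v
    unfolding G by (rule petz_g_ge) (use that Q in auto)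
  have upper: "petz_g \<alpha> A v \<le> G \<bullet> v + kl v u" if v: "\<And>j. 0 \<le> v $ j" for v
  proof -
    obtain Q' where Q': "Q' \<in> density_matrices" "\<And>j. 0 < v $ j \<Longrightarrow> 0 < overlap j Q'"
      "\<And>Q. Q \<in> density_matrices \<Longrightarrow> (\<And>j. 0 < v $ j \<Longrightarrow> 0 < overlap j Q) \<Longrightarrow>
         (\<Sum>j\<in>UNIV. v $ j * ln (overlap j Q)) \<le> (\<Sum>j\<in>UNIV. v $ j * ln (overlap j Q'))"
      using overlap_maximizer[of "\<lambda>j. v $ j"] v by blast
    define x where "x = (\<lambda>j. overlap j Q' / overlap j Q)"
    have "petz_g \<alpha> A v = p * (\<Sum>j\<in>UNIV. v $ j * ln (overlap j Q'))"
      by (rule petz_g_eq) (use v Q' in auto)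
    hence "petz_g \<alpha> A v - G \<bullet> v - kl v u =
        (\<Sum>j\<in>UNIV. p * (v $ j * ln (overlap j Q')) - p * (v $ j * ln (overlap j Q)) -
          (v $ j * ln (v $ j / u $ j) - v $ j + u $ j))"
      by (simp add: G kl_def sum_subtractf sum_distrib_left)
    also have "\<dots> \<le> (\<Sum>j\<in>UNIV. u $ j * x j powr p - u $ j)"
    proof (rule sum_mono)
      fix j
      show "p * (v $ j * ln (overlap j Q')) - p * (v $ j * ln (overlap j Q)) -
          (v $ j * ln (v $ j / u $ j) - v $ j + u $ j) \<le> u $ j * x j powr p - u $ j"
      proof (cases "v $ j = 0")
        \<comment> \<open>The left-hand side is then \<open>- u $ j\<close>, so no logarithm of
          \<open>overlap j Q'\<close> has to be controlled.\<close>
        case True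
        thus ?thesis using u0[of j] by simp
      next
        case False
        hence vj: "0 < v $ j" using v[of j] by simp
        have xj: "0 < x j" using Q'(2)[OF vj] Q(2)[of j] by (simp add: x_def)
        have "p * (v $ j * ln (overlap j Q')) - p * (v $ j * ln (overlap j Q)) - v $ j * ln (v $ j / u $ j) =
            v $ j * ln (x j powr p * u $ j / v $ j)"
          using vj xj u[of j] Q'(2)[OF vj] Q(2)[of j]
          by (simp add: x_def ln_div ln_mult ln_powr algebra_simps)
        also have "\<dots> \<le> v $ j * (x j powr p * u $ j / v $ j - 1)"
          using vj xj u[of j] by (intro mult_left_mono ln_le_minus_one) auto
        also have "\<dots> = u $ j * x j powr p - v $ j" using vj by (simp add: field_simps)
        finally show ?thesis by simp
      qed
    qed
    also have "\<dots> \<le> 0"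
      using optimal_overlaps[OF u Q(1,2) Q(3) Q'(1)] by (simp add: sum_subtractf x_def)
    finally show ?thesis by simp
  qed
  have "gradient (petz_g \<alpha> A) u = G"
    using u by (intro gradient_of_kl_bound)
      (auto simp: g inner_diff_right less_imp_le intro!: lower upper)
  thus "petz_g \<alpha> A u = gradient (petz_g \<alpha> A) u \<bullet> u"
    and "(\<And>j. 0 \<le> v $ j) \<Longrightarrow> gradient (petz_g \<alpha> A) u \<bullet> v \<le> petz_g \<alpha> A v"
    and "(\<And>j. 0 \<le> v $ j) \<Longrightarrow> petz_g \<alpha> A v \<le> gradient (petz_g \<alpha> A) u \<bullet> v + kl v u"
    using g lower upper by auto
qed

section \<open>Mirror descent\<close>

text \<open>By homogeneity the constant terms \<open>petz_g \<alpha> A u\<close> and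
  \<open>gradient (petz_g \<alpha> A) u \<bullet> u\<close> cancel.\<close>

lemma md_objective_kl:
  assumes u: "\<And>j. 0 < u $ j" and v: "\<And>j. 0 \<le> v $ j"
  shows "md_objective \<alpha> A u v = gradient (petz_g \<alpha> A) u \<bullet> v + kl v u"
  using petz_g_relative_smoothness(1)[OF u] bregman_neg_entropy[OF v u]
  by (simp add: md_objective_def inner_diff_right)

lemma mult_update_pos:
  assumes u: "\<And>j. 0 < u $ j"
  shows "0 < u \<bullet> exp_neg_grad \<alpha> A u" "0 < mult_update \<alpha> A u $ j" "mult_update \<alpha> A u \<in> prob_simplex"
proof -
  let ?Z = "u \<bullet> exp_neg_grad \<alpha> A u"
  show Z: "0 < ?Z"
    using u by (auto simp: inner_vec_def exp_neg_grad_def intro!: sum_pos mult_pos_pos)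
  have nth: "mult_update \<alpha> A u $ j = u $ j * exp_neg_grad \<alpha> A u $ j / ?Z" for j
    by (simp add: mult_update_def)
  show pos: "0 < mult_update \<alpha> A u $ j" for j
    using u Z by (simp add: nth exp_neg_grad_def)
  have "(\<Sum>j\<in>UNIV. mult_update \<alpha> A u $ j) = (\<Sum>j\<in>UNIV. u $ j * exp_neg_grad \<alpha> A u $ j) / ?Z"
    by (simp add: nth flip: sum_divide_distrib)
  also have "\<dots> = 1" using Z by (simp add: inner_vec_def)
  finally show "mult_update \<alpha> A u \<in> prob_simplex" using pos by (auto simp: prob_simplex_def intro: less_imp_le)
qed

text \<open>The Gibbs variational identity: on the simplex the objective is a relative entropy to
  the multiplicative update, up to a constant. It yields both the unique minimiser and the
  three-point identity of the descent analysis.\<close>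

lemma md_objective_mult_update:
  assumes u: "u \<in> prob_simplex" "\<And>j. 0 < u $ j" and v: "v \<in> prob_simplex"
  shows "md_objective \<alpha> A u v = kl v (mult_update \<alpha> A u) - ln (u \<bullet> exp_neg_grad \<alpha> A u)"
proof -
  let ?Z = "u \<bullet> exp_neg_grad \<alpha> A u" and ?m = "mult_update \<alpha> A u" and ?G = "gradient (petz_g \<alpha> A) u"
  have v0: "0 \<le> v $ j" for j using v by (simp add: prob_simplex_def)
  have Z: "0 < ?Z" and m: "?m \<in> prob_simplex" using mult_update_pos[OF u(2)] by auto
  have s: "(\<Sum>j\<in>UNIV. u $ j) = 1" "(\<Sum>j\<in>UNIV. v $ j) = 1" "(\<Sum>j\<in>UNIV. ?m $ j) = 1"
    using u v m by (auto simp: prob_simplex_def)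
  have "v $ j * ln (v $ j / ?m $ j) = ?G $ j * v $ j + v $ j * ln (v $ j / u $ j) + ln ?Z * v $ j" for j
  proof (cases "v $ j = 0")
    case False
    hence vj: "0 < v $ j" using v0[of j] by simp
    have "v $ j / ?m $ j = (v $ j / u $ j) * exp (?G $ j) * ?Z"
      using u(2)[of j] Z by (simp add: mult_update_def exp_neg_grad_def exp_minus field_simps)
    moreover have "ln (a * exp b * ?Z) = ln a + b + ln ?Z" if "0 < a" for a b :: real
      using that Z by (simp add: ln_mult_pos)
    ultimately have "ln (v $ j / ?m $ j) = ln (v $ j / u $ j) + ?G $ j + ln ?Z"
      using vj u(2)[of j] by (metis divide_pos_pos)
    thus ?thesis by (simp add: algebra_simps)
  qed simp
  hence "(\<Sum>j\<in>UNIV. v $ j * ln (v $ j / ?m $ j)) =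
      ?G \<bullet> v + (\<Sum>j\<in>UNIV. v $ j * ln (v $ j / u $ j)) + ln ?Z"
    by (simp add: sum.distrib inner_vec_def s flip: sum_distrib_left)
  thus ?thesis
    unfolding md_objective_kl[OF u(2) v0] kl_def by (simp add: sum.distrib sum_subtractf s)
qed

lemma md_arg_min_iff:
  assumes u: "u \<in> prob_simplex" "\<And>j. 0 < u $ j"
  shows "is_arg_min (md_objective \<alpha> A u) (\<lambda>v. v \<in> prob_simplex) v \<longleftrightarrow> v = mult_update \<alpha> A u"
proof -
  let ?m = "mult_update \<alpha> A u"
  note m = mult_update_pos(2,3)[OF u(2)]
  have kl0: "kl ?m ?m = 0" using m(1) by (simp add: kl_def less_imp_neq[symmetric])
  have nn: "0 \<le> kl v ?m" if "v \<in> prob_simplex" for v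
    using that m(1) by (intro kl_nonneg) (auto simp: prob_simplex_def)
  show ?thesis
  proof
    assume v: "is_arg_min (md_objective \<alpha> A u) (\<lambda>v. v \<in> prob_simplex) v"
    hence vs: "v \<in> prob_simplex" and "\<not> md_objective \<alpha> A u ?m < md_objective \<alpha> A u v"
      using m(2) by (auto simp: is_arg_min_def)
    hence "kl v ?m = 0"
      using nn[OF vs] by (simp add: md_objective_mult_update[OF u] m(2) kl0)
    thus "v = ?m" using vs m(1) by (intro kl_eq_0) (auto simp: prob_simplex_def)
  next
    assume "v = ?m"
    thus "is_arg_min (md_objective \<alpha> A u) (\<lambda>v. v \<in> prob_simplex) v"
      using m(2) nn by (auto simp: is_arg_min_def md_objective_mult_update[OF u] kl0 not_less)
  qed
qed

text \<open>The number \<open>- ln (u \<bullet> exp_neg_grad \<alpha> A u)\<close> is the minimal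
  value of the objective. Relative smoothness puts it above \<open>petz_g\<close> at the update; the
  lower bound of \<open>petz_g_relative_smoothness\<close> and the Gibbs identity put it below
  \<open>petz_g \<alpha> A v + kl v u - kl v ?m\<close>. The first claim is the case
  \<open>v = u\<close>.\<close>

lemma mirror_descent_step:
  assumes u: "u \<in> prob_simplex" "\<And>j. 0 < u $ j"
  shows "petz_g \<alpha> A (mult_update \<alpha> A u) \<le> petz_g \<alpha> A u"
    and "v \<in> prob_simplex \<Longrightarrow>
      petz_g \<alpha> A (mult_update \<alpha> A u) - petz_g \<alpha> A v \<le> kl v u - kl v (mult_update \<alpha> A u)"
proof -
  let ?m = "mult_update \<alpha> A u"
  note m = mult_update_pos(2,3)[OF u(2)]
  have nonneg: "0 \<le> v $ j" if "v \<in> prob_simplex" for v :: "real^'n" and j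
    using that by (simp add: prob_simplex_def)
  have "petz_g \<alpha> A ?m \<le> md_objective \<alpha> A u ?m"
    unfolding md_objective_kl[OF u(2) nonneg[OF m(2)]]
    by (rule petz_g_relative_smoothness(3)[OF u(2) nonneg[OF m(2)]])
  hence 1: "petz_g \<alpha> A ?m \<le> - ln (u \<bullet> exp_neg_grad \<alpha> A u)"
    using m by (simp add: md_objective_mult_update[OF u] kl_def less_imp_neq[symmetric])
  have 2: "- ln (u \<bullet> exp_neg_grad \<alpha> A u) \<le> petz_g \<alpha> A v + kl v u - kl v ?m" if "v \<in> prob_simplex" for v
    using md_objective_mult_update[OF u that] md_objective_kl[OF u(2) nonneg[OF that]]
      petz_g_relative_smoothness(2)[OF u(2) nonneg[OF that]] by simp
  have "kl u u = 0" using u(2) by (simp add: kl_def less_imp_neq[symmetric])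
  moreover have "0 \<le> kl u ?m" using u(1) m(1) by (intro kl_nonneg nonneg) auto
  ultimately show "petz_g \<alpha> A ?m \<le> petz_g \<alpha> A u" using 1 2[OF u(1)] by simp
  show "petz_g \<alpha> A ?m - petz_g \<alpha> A v \<le> kl v u - kl v ?m" if "v \<in> prob_simplex"
    using 1 2[OF that] by simp
qed

text \<open>The bounds of \<open>mirror_descent_step\<close> telescope, and since the values
  decrease, \<open>T\<close> times the last gap is at most the sum of the first \<open>T\<close>
  gaps.\<close>

lemma mirror_descent_rate:
  assumes w1: "w 1 = (\<chi> j. 1 / real CARD('n))"
    and step: "\<And>t. t \<ge> 1 \<Longrightarrow>
      is_arg_min (md_objective \<alpha> A (w t)) (\<lambda>v. v \<in> prob_simplex) (w (t + 1))"
    and v: "v \<in> prob_simplex" and T: "T \<ge> 1"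
  shows "petz_g \<alpha> A (w (T + 1)) - petz_g \<alpha> A v \<le> ln (real CARD('n)) / real T"
proof -
  \<comment> \<open>Strict positivity is carried along, since the gradient of \<open>petz_g\<close>
    is identified only at vectors with positive entries.\<close>
  have w: "w t \<in> prob_simplex \<and> (\<forall>j. 0 < w t $ j)" if "t \<ge> 1" for t
    using that
  proof (induction t rule: dec_induct)
    case base
    show ?case using w1 by (simp add: prob_simplex_def)
  next
    case (step t)
    hence "w (Suc t) = mult_update \<alpha> A (w t)" using md_arg_min_iff[of "w t"] assms(2)[of t] by simp
    thus ?case using mult_update_pos[of "w t"] step.IH by simp
  qed
  have upd: "w (Suc t) = mult_update \<alpha> A (w t)" if "t \<ge> 1" for t
    using md_arg_min_iff[of "w t"] step[OF that] w[OF that] by simp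
  \<comment> \<open>The induction starts at \<open>T = 0\<close>, where both sides vanish. In its
    step the old factor \<open>T\<close> is first moved to the new, smaller gap, and then one more
    decrement is added.\<close>
  have main: "real T * (petz_g \<alpha> A (w (Suc T)) - petz_g \<alpha> A v) \<le> kl v (w 1) - kl v (w (Suc T))" for T
  proof (induction T)
    case (Suc T)
    let ?e = "\<lambda>t. petz_g \<alpha> A (w t) - petz_g \<alpha> A v"
    have "?e (Suc (Suc T)) \<le> ?e (Suc T)"
      using mirror_descent_step(1)[of "w (Suc T)"] w[of "Suc T"] upd[of "Suc T"] by simp
    hence "real T * ?e (Suc (Suc T)) \<le> real T * ?e (Suc T)" by (intro mult_left_mono) auto
    moreover have "?e (Suc (Suc T)) \<le> kl v (w (Suc T)) - kl v (w (Suc (Suc T)))"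
      using mirror_descent_step(2)[of "w (Suc T)" v] w[of "Suc T"] upd[of "Suc T"] v by simp
    ultimately show ?case using Suc.IH by (simp add: algebra_simps)
  qed simp
  have v0: "0 \<le> v $ j" and v1: "(\<Sum>j\<in>UNIV. v $ j) = 1" for j using v by (auto simp: prob_simplex_def)
  have "kl v (w 1) \<le> ln (real CARD('n))"
  proof -
    \<comment> \<open>From the uniform start the ratio is \<open>v $ j\<close> times
      \<open>CARD('n)\<close>, and entries of a probability vector are at most 1.\<close>
    have "v $ j * ln (v $ j / w 1 $ j) \<le> v $ j * ln (real CARD('n))" for j
    proof (cases "v $ j = 0")
      case False
      have "v $ j \<le> 1" using v0 v1 member_le_sum[of j UNIV "\<lambda>j. v $ j"] by simp
      hence "v $ j / w 1 $ j \<le> real CARD('n)" unfolding w1 by (simp add: mult_left_le_one_le)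
      thus ?thesis using False v0[of j] by (intro mult_left_mono ln_mono) (auto simp: w1[unfolded One_nat_def])
    qed simp
    hence "(\<Sum>j\<in>UNIV. v $ j * ln (v $ j / w 1 $ j)) \<le> (\<Sum>j\<in>UNIV. v $ j * ln (real CARD('n)))"
      by (intro sum_mono)
    thus ?thesis using w[of 1]
      by (simp add: kl_def sum.distrib sum_subtractf v1 prob_simplex_def flip: sum_distrib_right)
  qed
  moreover have "0 \<le> kl v (w (Suc T))" using w[of "Suc T"] v0 by (intro kl_nonneg) auto
  ultimately have "real T * (petz_g \<alpha> A (w (Suc T)) - petz_g \<alpha> A v) \<le> ln (real CARD('n))"
    using main[of T] by linarith
  thus ?thesis using T by (simp add: field_simps)
qed

end

section \<open>Equivalence of the two update rules, and the convergence rate\<close>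

theorem theorem6p5:
  fixes \<alpha> :: real
    and A :: "'n::finite \<Rightarrow> complex^'d^'d"
    and w :: "nat \<Rightarrow> real^'n"
    and w_star :: "real^'n"
  assumes alpha: "1/2 < \<alpha>" "\<alpha> < 1"
    and A_density: "\<And>j. A j \<in> density_matrices"
    and A_full_rank: "rank (\<Sum>j\<in>UNIV. A j) = CARD('d)"
    and w_init: "w 1 = (\<chi> j. 1 / real CARD('n))"
    and w_step: "\<And>t. t \<ge> 1 \<Longrightarrow>
      is_arg_min (md_objective \<alpha> A (w t)) (\<lambda>v. v \<in> prob_simplex) (w (t + 1))"
    and w_star: "is_arg_min (petz_g \<alpha> A) (\<lambda>v. v \<in> prob_simplex) w_star"
  shows "(\<forall>u\<in>prob_simplex. (\<forall>j. 0 < u $ j) \<longrightarrow>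
            (\<forall>v. is_arg_min (md_objective \<alpha> A u) (\<lambda>v. v \<in> prob_simplex) v
                 \<longleftrightarrow> v = mult_update \<alpha> A u))
       \<and> (\<forall>T\<ge>1. petz_g \<alpha> A (w (T + 1)) - petz_g \<alpha> A w_star \<le> ln (real CARD('n)) / real T)"
proof -
  interpret petz \<alpha> A
    using alpha A_density A_full_rank by unfold_locales auto
  have "w_star \<in> prob_simplex" using w_star by (simp add: is_arg_min_def)
  thus ?thesis using md_arg_min_iff mirror_descent_rate[OF w_init w_step] by blast
qed

end
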